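(* Let $U\subset\hat{\mathbb{C}}$ be a simply connected domain such that $K:=\hat{\mathbb{C}}\setminus U$ contains more than one point, and let $p$ be a prime end of $U$. Then the impression $I(p)$ contains at most two points at which $K$ is locally connected.
   Context: $\hat{\mathbb{C}}$ is the Riemann sphere; diameters are taken in the spherical metric and closures in $\hat{\mathbb{C}}$. Local connectivity at a point: $K$ is locally connected at $z_0\in K$ if $z_0$ has arbitrarily small connected (not necessarily open) neighborhoods in $K$; that is, for every neighborhood $N$ of $z_0$ in $K$ there is a connected set $N'\subset N$ containing $z_0$ in its interior relative to $K$. Prime ends: A crosscut $C$ of $U$ is a closed Jordan arc which intersects $\hat{\mathbb{C}}\setminus U$ exactly in its two endpoints; a crosscut separates $U$ into exactly two components. Fix a base point $b\in U$ (its choice is immaterial). If $C$ is a crosscut of $U$ with $b\notin C$, let $U_C$ be the component of $U\setminus C$ not containing $b$. A prime end of $U$ is represented by a sequence of pairwise disjoint crosscuts $(C_n)$, none containing $b$, such that $\operatorname{diam} C_n\to 0$ and $C_{n+1}\subset\overline{U_{C_n}}$ for all $n$. Two such sequences $(C_n)$ and $(\tilde C_n)$ represent the same prime end if, for every $n$, $\tilde C_j\cap U\subset U_{C_n}$ for all sufficiently large $j$, and vice versa with the roles of the two sequences exchanged. The impression of a prime end $p$ represented by $(C_n)$ is $I(p):=\bigcap_n\overline{U_{C_n}}\subset\partial U$. *)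

theory Defs
  imports "HOL-Analysis.Analysis"
begin

(* The Riemann sphere is modelled by the unit sphere of complex * real, where z in the plane
   corresponds to (2 z / (1 + |z|^2), (|z|^2 - 1) / (1 + |z|^2)) and infinity to (0, 1).
   It is compact, so closures in the sphere are closures in the ambient Euclidean space. *)
definition riemann_sphere :: "(complex \<times> real) set"
  where "riemann_sphere = sphere 0 1"

(* Great-circle distance, i.e. the distance of the metric 2 |dz| / (1 + |z|^2). *)
definition spherical_dist :: "complex \<times> real \<Rightarrow> complex \<times> real \<Rightarrow> real"
  where "spherical_dist x y = arccos (x \<bullet> y)"

definition spherical_diameter :: "(complex \<times> real) set \<Rightarrow> real"
  where "spherical_diameter S = (SUP (x, y) \<in> S \<times> S. spherical_dist x y)"

definition crosscut :: "(complex \<times> real) set \<Rightarrow> (complex \<times> real) set \<Rightarrow> bool"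
  where "crosscut U C \<longleftrightarrow>
    (\<exists>g. arc g \<and> C = path_image g \<and> C \<subseteq> riemann_sphere \<and>
         C \<inter> (riemann_sphere - U) = {pathstart g, pathfinish g})"

(* The component U_C of U - C not containing the base point b.  It is unique when U is a simply
   connected domain, C is a crosscut of U and b is in U - C. *)
definition crosscut_component ::
    "(complex \<times> real) set \<Rightarrow> complex \<times> real \<Rightarrow> (complex \<times> real) set \<Rightarrow> (complex \<times> real) set"
  where "crosscut_component U b C = (THE V. V \<in> components (U - C) \<and> b \<notin> V)"

definition prime_end_sequences ::
    "(complex \<times> real) set \<Rightarrow> complex \<times> real \<Rightarrow> (nat \<Rightarrow> (complex \<times> real) set) set"
  where "prime_end_sequences U b =
    {C. (\<forall>n. crosscut U (C n) \<and> b \<notin> C n) \<and>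
        disjoint_family C \<and>
        (\<lambda>n. spherical_diameter (C n)) \<longlonglongrightarrow> 0 \<and>
        (\<forall>n. C (Suc n) \<subseteq> closure (crosscut_component U b (C n)))}"

definition prime_end_equiv ::
    "(complex \<times> real) set \<Rightarrow> complex \<times> real \<Rightarrow>
     ((nat \<Rightarrow> (complex \<times> real) set) \<times> (nat \<Rightarrow> (complex \<times> real) set)) set"
  where "prime_end_equiv U b =
    {(C, D). C \<in> prime_end_sequences U b \<and> D \<in> prime_end_sequences U b \<and>
       (\<forall>n. \<forall>\<^sub>F j in sequentially. D j \<inter> U \<subseteq> crosscut_component U b (C n)) \<and>
       (\<forall>n. \<forall>\<^sub>F j in sequentially. C j \<inter> U \<subseteq> crosscut_component U b (D n))}"

definition prime_ends ::
    "(complex \<times> real) set \<Rightarrow> complex \<times> real \<Rightarrow> (nat \<Rightarrow> (complex \<times> real) set) set set"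
  where "prime_ends U b = prime_end_sequences U b // prime_end_equiv U b"

(* The set given by the intersection formula for every sequence C representing p; it does not
   depend on C when U is a simply connected domain. *)
definition impression ::
    "(complex \<times> real) set \<Rightarrow> complex \<times> real \<Rightarrow> (nat \<Rightarrow> (complex \<times> real) set) set \<Rightarrow>
     (complex \<times> real) set"
  where "impression U b p =
    (THE I. \<forall>C\<in>p. I = (\<Inter>n. closure (crosscut_component U b (C n))))"

(* Neighbourhoods are connected but not necessarily open, which is the library's
   weakly_locally_connected_at (locally_connected_at asks for open ones).  That predicate holds
   vacuously at points outside K, hence the first conjunct. *)
definition locally_connected_at_point :: "(complex \<times> real) set \<Rightarrow> complex \<times> real \<Rightarrow> bool"
  where "locally_connected_at_point K z \<longleftrightarrow>
    z \<in> K \<and> weakly_locally_connected_at z (top_of_set K)"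

end

(* Send the base point b to infinity, so that K becomes a non-separating plane continuum and U_C the
   bounded complementary component of K Un C.  If crosscuts C_n of the chain accumulate at an impression
   point z where K is locally connected, their endpoints are joined by small continua in K, which by
   Janiszewski's theorem confine the regions U_{C_n} to small discs, so that the impression is {z}.
   Otherwise, given three points z_i of local connectivity in the impression, all late crosscuts stay
   away from them.  Local connectivity yields disjoint non-separating continua X_i in K that contain all
   of K near z_i, and between suitable crosscuts of the chain there are three disjoint regions, each of
   which contains points near every z_i.  From each region every X_i can therefore be reached along a
   segment, which embeds K_{3,3} in the plane. *)
theory Submission
  imports Defs "HOL-Complex_Analysis.Riemann_Mapping"
begin

section \<open>Continua and regions in the plane\<close>

text \<open>The obstacle is that \<open>K\<close> is an arbitrary continuum: regions need not be
  bounded by Jordan curves, and small connected pieces of \<open>K\<close> need not contain paths.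
  So separation is always derived from Janiszewski's theorem or its dual, and one side of K_{3,3}
  consists of fat vertices: continua that do not separate the plane, so that attaching an arc at a
  single point keeps the complement connected. The same obstruction is used twice. It also shows
  that a crosscut leaves just one region besides the outer one, which gives U_C its meaning and
  allows points of U_{C_n} to be joined there. The regions between crosscuts come from compactness:
  a system of paths in one U_{C_n} is left behind by all late crosscuts.\<close>

lemma frontier_component_Compl_subset:
  fixes F :: "'a::real_normed_vector set"
  assumes "closed F"
  shows "frontier (connected_component_set (- F) x) \<subseteq> F"
proof -
  have "frontier (connected_component_set (- F) x) \<subseteq> frontier (- F)"
    by (rule frontier_of_connected_component_subset)
  also have "\<dots> \<subseteq> F" using assms by (simp add: frontier_subset_closed)
  finally show ?thesis .
qed

text \<open>Of the three cycles of a theta graph, a point cut off from \<open>w\<close> by one is cut off by a second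
  one as well, and the two complementary components of that point agree.  Such a component is bounded by
  the common edge of the two cycles only, which does not separate the plane.\<close>

lemma theta_graph_no_common_face:
  fixes H T :: "nat \<Rightarrow> complex set"
  assumes comp: "\<And>i. i < 3 \<Longrightarrow> compact (H i)"
    and conn: "\<And>i. i < 3 \<Longrightarrow> connected (H i)"
    and nonsep: "\<And>i. i < 3 \<Longrightarrow> connected (- H i)"
    and int: "\<And>i j. i < 3 \<Longrightarrow> j < 3 \<Longrightarrow> i \<noteq> j \<Longrightarrow> H i \<inter> H j = X"
    and disc: "\<not> connected X"
    and w: "\<And>i. i < 3 \<Longrightarrow> w \<notin> H i"
    and T: "\<And>i. i < 3 \<Longrightarrow> connected (T i)"
      "\<And>i. i < 3 \<Longrightarrow> insert w (H i - X) \<subseteq> T i"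
      "\<And>i j. i < 3 \<Longrightarrow> j < 3 \<Longrightarrow> i \<noteq> j \<Longrightarrow> T i \<inter> H j = {}"
  shows False
proof -
  have H12: "\<not> connected (- (H 0 \<union> H 1))"
    using Janiszewski_dual[of "H 0" "H 1"] comp conn int disc by (metis one_less_numeral_iff semiring_norm(77) zero_less_numeral zero_neq_one)
  have "\<exists>v. v \<in> - (H 0 \<union> H 1) \<and> \<not> connected_component (- (H 0 \<union> H 1)) v w"
  proof (rule ccontr)
    assume "\<nexists>v. v \<in> - (H 0 \<union> H 1) \<and> \<not> connected_component (- (H 0 \<union> H 1)) v w"
    then have "\<forall>x \<in> - (H 0 \<union> H 1). connected_component (- (H 0 \<union> H 1)) x w" by blast
    then have "connected (- (H 0 \<union> H 1))"
      unfolding connected_iff_connected_component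
      by (meson connected_component_sym connected_component_trans)
    with H12 show False by blast
  qed
  then obtain v where v: "v \<notin> H 0" "v \<notin> H 1" "\<not> connected_component (- (H 0 \<union> H 1)) v w"
    by blast
  define V where "V i j = connected_component_set (- (H i \<union> H j)) v" for i j
  \<comment> \<open>A point of \<open>H k\<close> in \<open>V i j\<close> would lie off
    \<open>X\<close>, and \<open>T k\<close> would join it to \<open>w\<close> without meeting
    \<open>H i\<close> or \<open>H j\<close>.\<close>
  have V_disj: "V i j \<inter> H k = {}" if "i < 3" "j < 3" "k < 3" "k \<noteq> i" "k \<noteq> j"
    "\<not> connected_component (- (H i \<union> H j)) v w" for i j k
  proof (rule ccontr)
    assume "V i j \<inter> H k \<noteq> {}"
    then obtain x where x: "connected_component (- (H i \<union> H j)) v x" "x \<in> H k" by (auto simp: V_def)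
    then have "x \<notin> X" using connected_component_in[OF x(1)] int[of i k] that by blast
    then have "x \<in> T k" "w \<in> T k" "T k \<subseteq> - (H i \<union> H j)"
      using T(2)[of k] T(3)[of k i] T(3)[of k j] that x by auto
    then have "connected_component (- (H i \<union> H j)) x w"
      using T(1)[of k] that by (auto simp: connected_component_def)
    with x(1) that show False using connected_component_trans by metis
  qed
  have v2: "v \<notin> H 2"
  proof -
    have "v \<in> V 0 1" using v unfolding V_def by (simp add: connected_component_refl_eq del: Compl_Un)
    then show ?thesis using V_disj[of 0 1 2] v by auto
  qed
  have key: False if k: "k < 3" "l < 3" "m < 3" "k \<noteq> l" "k \<noteq> m" "l \<noteq> m"
      and kl: "\<not> connected_component (- (H k \<union> H l)) v w"
      and km: "\<not> connected_component (- (H k \<union> H m)) v w"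
      and vv: "v \<notin> H k" "v \<notin> H l" "v \<notin> H m" for k l m
  proof -
    have conV: "connected (V i j)" for i j unfolding V_def by simp
    have "V k l \<subseteq> - (H k \<union> H m)"
      using V_disj[of k l m] k kl connected_component_subset[of "- (H k \<union> H l)" v] unfolding V_def by blast
    then have 1: "V k l \<subseteq> V k m"
      unfolding V_def by (intro connected_component_maximal) (use vv conV in auto)
    have "V k m \<subseteq> - (H k \<union> H l)"
      using V_disj[of k m l] k km connected_component_subset[of "- (H k \<union> H m)" v] unfolding V_def by blast
    then have 2: "V k m \<subseteq> V k l"
      unfolding V_def by (intro connected_component_maximal) (use vv conV in auto)
    from 1 2 have eq: "V k l = V k m" by blast
    have fr: "frontier (V i j) \<subseteq> H i \<union> H j" if "i < 3" "j < 3" for i j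
      unfolding V_def using that comp
      by (intro frontier_component_Compl_subset closed_Un) (auto simp: compact_imp_closed)
    have "frontier (V k l) \<subseteq> H k \<union> (H l \<inter> H m)" using fr[of k l] fr[of k m] eq k by auto
    then have "frontier (V k l) \<subseteq> H k" using int[of l m] int[of k l] k by auto
    moreover have "V k l \<subseteq> - H k" using connected_component_subset unfolding V_def by fastforce
    moreover have "v \<in> V k l" using vv by (simp add: V_def connected_component_refl_eq)
    moreover have "w \<in> - H k" "w \<notin> V k l" using w k kl by (auto simp: V_def)
    ultimately show False
      using connected_Int_frontier[OF nonsep[of k], of "V k l"] k by blast
  qed
  \<comment> \<open>The second cycle: if neither \<open>H 0 \<union> H 2\<close> nor
    \<open>H 1 \<union> H 2\<close> separated \<open>v\<close> from \<open>w\<close>, then, as they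
    meet in the connected set \<open>H 2\<close>, neither would their union, which contains
    \<open>H 0 \<union> H 1\<close>.\<close>
  have "\<not> connected_component (- (H 0 \<union> H 1 \<union> H 2)) v w"
    using v by (meson Compl_subset_Compl_iff Un_upper1 connected_component_of_subset)
  moreover have "H 0 \<union> H 1 \<union> H 2 = (H 0 \<union> H 2) \<union> (H 1 \<union> H 2)" by blast
  ultimately have "\<not> connected_component (- ((H 0 \<union> H 2) \<union> (H 1 \<union> H 2))) v w" by metis
  moreover have "(H 0 \<union> H 2) \<inter> (H 1 \<union> H 2) = H 2" using int[of 0 1] int[of 0 2] by auto
  ultimately consider "\<not> connected_component (- (H 0 \<union> H 2)) v w" | "\<not> connected_component (- (H 1 \<union> H 2)) v w"
    using Janiszewski[of "H 0 \<union> H 2" "H 1 \<union> H 2" v w] comp conn[of 2]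
    by (metis compact_Un compact_imp_closed lessI numeral_2_eq_2 numeral_3_eq_3 one_less_numeral_iff semiring_norm(77) zero_less_numeral)
  then show False
  proof cases
    case 1
    then show ?thesis using key[of 0 1 2] v v2 by simp
  next
    case 2
    then show ?thesis using key[of 1 0 2] v v2 by (simp add: Un_commute)
  qed
qed

section \<open>Arcs through regions and the K_{3,3} obstruction\<close>

definition accessible_from :: "complex set \<Rightarrow> complex set \<Rightarrow> bool" where
  "accessible_from V X \<longleftrightarrow> (\<exists>h. path h \<and> pathstart h \<in> V \<and> pathfinish h \<in> X \<and> path_image h - {pathfinish h} \<subseteq> V)"

text \<open>Walk from a point of \<open>V\<close> in \<open>B\<close> straight towards
  \<open>z\<close>. The first point where the segment leaves \<open>V\<close> is in
  \<open>frontier V\<close> and, by convexity, in \<open>B\<close>, hence in \<open>X\<close>;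
  \<open>z\<close> is only a target and need not be reached.\<close>

lemma accessible_fromI:
  assumes "open V" "frontier V \<subseteq> F" "convex B" "B \<inter> F \<subseteq> X" "V \<inter> B \<noteq> {}" "z \<in> B" "z \<notin> V"
  shows "accessible_from V X"
proof -
  obtain u where u: "u \<in> V" "u \<in> B" using assms by auto
  have "pathstart (linepath u z) \<in> closure V" "pathfinish (linepath u z) \<notin> V"
    using u assms closure_subset by auto
  then obtain h where h: "path h" "pathstart h = u" "path_image h \<subseteq> closed_segment u z"
      "path_image h - {pathfinish h} \<subseteq> interior V" "pathfinish h \<in> frontier V"
    using exists_path_subpath_to_frontier[of "linepath u z" V] by auto
  have "pathfinish h \<in> B"
    using h(3) closed_segment_subset[of u B z] u assms pathfinish_in_path_image by blast
  then have "pathfinish h \<in> X" using assms h by blast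
  then show ?thesis unfolding accessible_from_def
    using h u assms by (metis interior_open)
qed

lemma accessible_from_arc:
  assumes "open V" "connected V" "accessible_from V X" "accessible_from V Y" "X \<inter> Y = {}"
    "V \<inter> (X \<union> Y) = {}"
  obtains g where "arc g" "pathstart g \<in> X" "pathfinish g \<in> Y"
    "path_image g - {pathstart g, pathfinish g} \<subseteq> V"
proof -
  obtain h where h: "path h" "pathstart h \<in> V" "pathfinish h \<in> X" "path_image h - {pathfinish h} \<subseteq> V"
    using assms unfolding accessible_from_def by blast
  obtain k where k: "path k" "pathstart k \<in> V" "pathfinish k \<in> Y" "path_image k - {pathfinish k} \<subseteq> V"
    using assms unfolding accessible_from_def by blast
  obtain q where q: "path q" "path_image q \<subseteq> V" "pathstart q = pathstart h" "pathfinish q = pathstart k"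
    using assms h k by (metis connected_open_path_connected path_connected_def)
  define p where "p = reversepath h +++ q +++ k"
  have p: "path p" "pathstart p = pathfinish h" "pathfinish p = pathfinish k" unfolding p_def using h k q by auto
  have sub: "path_image p \<subseteq> path_image h \<union> path_image q \<union> path_image k"
    unfolding p_def using path_image_join_subset[of "reversepath h" "q +++ k"] path_image_join_subset[of q k] by auto
  have "pathfinish h \<noteq> pathfinish k" using h k assms by auto
  then obtain g where g: "arc g" "path_image g \<subseteq> path_image p" "pathstart g = pathfinish h" "pathfinish g = pathfinish k"
    using path_contains_arc[OF p] by metis
  show thesis
    by (rule that[of g]) (use g h k q sub in auto)
qed

text \<open>The continua and the regions would give a planar \<open>K\<^bsub>3,3\<^esub>\<close>: take \<open>X 0\<close> and \<open>X 1\<close> as the two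
  branch points of a theta graph with one edge through each region; then \<open>X 2\<close> lies in a face that
  touches all three edges.\<close>

lemma three_continua_three_regions:
  fixes X V :: "nat \<Rightarrow> complex set"
  assumes X: "\<And>i. i < 3 \<Longrightarrow> compact (X i)" "\<And>i. i < 3 \<Longrightarrow> connected (X i)" "\<And>i. i < 3 \<Longrightarrow> connected (- X i)"
    and XX: "\<And>i j. i < j \<Longrightarrow> j < 3 \<Longrightarrow> X i \<inter> X j = {}"
    and V: "\<And>i. i < 3 \<Longrightarrow> open (V i)" "\<And>i. i < 3 \<Longrightarrow> connected (V i)"
    and VV: "\<And>i j. i < j \<Longrightarrow> j < 3 \<Longrightarrow> V i \<inter> V j = {}"
    and VX: "\<And>i j. i < 3 \<Longrightarrow> j < 3 \<Longrightarrow> V i \<inter> X j = {}"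
    and acc: "\<And>i j. i < 3 \<Longrightarrow> j < 3 \<Longrightarrow> accessible_from (V i) (X j)"
  shows False
proof -
  have "\<exists>g. arc g \<and> pathstart g \<in> X 0 \<and> pathfinish g \<in> X 1 \<and> path_image g - {pathstart g, pathfinish g} \<subseteq> V i"
    if "i < 3" for i
    by (rule accessible_from_arc[of "V i" "X 0" "X 1"]) (use V acc XX VX[of i 0] VX[of i 1] that in auto)
  then obtain g where g: "\<And>i. i < 3 \<Longrightarrow> arc (g i)" "\<And>i. i < 3 \<Longrightarrow> pathstart (g i) \<in> X 0"
    "\<And>i. i < 3 \<Longrightarrow> pathfinish (g i) \<in> X 1"
    "\<And>i. i < 3 \<Longrightarrow> path_image (g i) - {pathstart (g i), pathfinish (g i)} \<subseteq> V i" by metis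
  have acc2: "\<exists>h. path h \<and> pathstart h \<in> V i \<and> pathfinish h \<in> X 2 \<and> path_image h - {pathfinish h} \<subseteq> V i"
    if "i < 3" for i
    using acc[of i 2] that unfolding accessible_from_def by auto
  then obtain h where h: "\<And>i. i < 3 \<Longrightarrow> path (h i)" "\<And>i. i < 3 \<Longrightarrow> pathstart (h i) \<in> V i"
    "\<And>i. i < 3 \<Longrightarrow> pathfinish (h i) \<in> X 2"
    "\<And>i. i < 3 \<Longrightarrow> path_image (h i) - {pathfinish (h i)} \<subseteq> V i" by metis
  have X01: "X 0 \<inter> X 1 = {}" "X 0 \<inter> X 2 = {}" "X 1 \<inter> X 2 = {}" using XX by auto
  have V_disj: "V i \<inter> V j = {}" if "i < 3" "j < 3" "i \<noteq> j" for i j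
    using VV that by (metis Int_commute linorder_neqE_nat)
  define H where "H i = X 0 \<union> path_image (g i) \<union> X 1" for i
  have gX: "path_image (g i) \<inter> X 0 = {pathstart (g i)}" "path_image (g i) \<inter> X 1 = {pathfinish (g i)}"
    "path_image (g i) \<inter> X 2 = {}"
    if "i < 3" for i
  proof -
    have "path_image (g i) \<subseteq> V i \<union> {pathstart (g i), pathfinish (g i)}"
      using g(4)[OF that] by blast
    moreover have "V i \<inter> X 0 = {}" "V i \<inter> X 1 = {}" "V i \<inter> X 2 = {}" using VX that by auto
    moreover have "pathstart (g i) \<in> path_image (g i)" "pathfinish (g i) \<in> path_image (g i)" by auto
    ultimately show "path_image (g i) \<inter> X 0 = {pathstart (g i)}" "path_image (g i) \<inter> X 1 = {pathfinish (g i)}"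
      "path_image (g i) \<inter> X 2 = {}"
      using g(2,3)[OF that] X01 by blast+
  qed
  have HV: "H i - (X 0 \<union> X 1) \<subseteq> V i" if "i < 3" for i
    using g(2-4)[OF that] by (auto simp: H_def)
  \<comment> \<open>From \<open>w\<close> the set \<open>T i\<close> reaches the edge in
    \<open>V i\<close> through \<open>X 2\<close>, so the face containing \<open>w\<close> touches
    all three edges. All that matters of \<open>w\<close> is that it lies in
    \<open>X 2\<close>.\<close>
  define w where "w = pathfinish (h 0)"
  have w: "w \<in> X 2" using h by (simp add: w_def)
  define T where "T i = V i \<union> path_image (h i) \<union> X 2" for i
  have T_sub: "T i \<subseteq> V i \<union> X 2" if "i < 3" for i
    using h(3,4)[OF that] by (auto simp: T_def)
  show False
  proof (rule theta_graph_no_common_face[of H "X 0 \<union> X 1" w T])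
    fix i :: nat assume i: "i < 3"
    note arc = g(1)[OF i]
    show "compact (H i)" using X i arc by (simp add: H_def compact_Un compact_arc_image)
    have cg: "connected (path_image (g i))" using arc by (simp add: connected_arc_image)
    have c0: "connected (X 0 \<union> path_image (g i))"
      by (rule connected_Un) (use X i cg gX[OF i] in auto)
    show "connected (H i)" unfolding H_def
      by (rule connected_Un) (use c0 X i gX[OF i] in auto)
    \<comment> \<open>Each new piece meets the previous ones in a single point, so Janiszewski's
      theorem keeps the complement connected.\<close>
    have "connected (- (X 0 \<union> path_image (g i)))"
      by (rule Janiszewski_connected)
        (use X gX[OF i] arc in \<open>auto simp: Int_commute connected_arc_complement closed_arc_image\<close>)
    moreover have "(X 0 \<union> path_image (g i)) \<inter> X 1 = {pathfinish (g i)}" using gX[OF i] X01 by blast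
    ultimately show "connected (- H i)"
      unfolding H_def using X arc Janiszewski_connected[of "X 0 \<union> path_image (g i)" "X 1"]
      by (simp add: compact_Un compact_arc_image compact_imp_closed del: Compl_Un)
    show "w \<notin> H i" using w gX[OF i] X01 by (auto simp: H_def)
    have "connected (V i \<union> path_image (h i))"
      by (rule connected_Un) (use V(2)[OF i] h(1,2)[OF i] pathstart_in_path_image[of "h i"] in \<open>blast intro: connected_path_image\<close>)+
    then show "connected (T i)" unfolding T_def
      by (rule connected_Un) (use X(2)[of 2] h(3)[OF i] pathfinish_in_path_image[of "h i"] in \<open>simp, blast\<close>)
    show "insert w (H i - (X 0 \<union> X 1)) \<subseteq> T i" using w HV[OF i] by (auto simp: T_def)
  next
    fix i j :: nat assume ij: "i < 3" "j < 3" "i \<noteq> j"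
    show "H i \<inter> H j = X 0 \<union> X 1"
      using HV[of i] HV[of j] V_disj[of i j] ij by (auto simp: H_def)
    show "T i \<inter> H j = {}"
      using T_sub[of i] HV[of j] V_disj[of i j] VX[of i 0] VX[of i 1] ij gX[of j] X01
      by (fastforce simp: H_def)
  next
    show "\<not> connected (X 0 \<union> X 1)"
    proof
      assume "connected (X 0 \<union> X 1)"
      then have "X 0 = {} \<or> X 1 = {}"
        using connected_closed_set[of "X 0 \<union> X 1"] X(1)[of 0] X(1)[of 1] X01(1)
        by (metis closed_Un compact_imp_closed one_less_numeral_iff semiring_norm(77) zero_less_numeral)
      then show False using g(2,3)[of 0] by auto
    qed
  qed
qed

section \<open>Crosscuts of a plane continuum\<close>

lemma frontier_components_Compl_subset:
  fixes F :: "'a::real_normed_vector set"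
  shows "closed F \<Longrightarrow> V \<in> components (- F) \<Longrightarrow> frontier V \<subseteq> F"
  by (metis components_iff frontier_component_Compl_subset)

definition plane_crosscut :: "complex set \<Rightarrow> complex set \<Rightarrow> bool" where
  "plane_crosscut K C \<longleftrightarrow> (\<exists>g. arc g \<and> C = path_image g \<and> C \<inter> K = {pathstart g, pathfinish g})"

lemma plane_crosscut_compact: "plane_crosscut K C \<Longrightarrow> compact C"
  by (auto simp: plane_crosscut_def compact_arc_image)

lemma plane_crosscut_connected: "plane_crosscut K C \<Longrightarrow> connected C"
  by (auto simp: plane_crosscut_def connected_arc_image)

lemma arc_image_Icc:
  assumes "arc g" "0 \<le> s" "s < t" "t \<le> 1"
  shows "compact (g ` {s..t})" "connected (g ` {s..t})" "connected (- g ` {s..t} :: complex set)"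
proof -
  have "arc (subpath s t g)" using assms by (intro arc_subpath_arc) auto
  moreover have "path_image (subpath s t g) = g ` {s..t}" using assms by (simp add: path_image_subpath)
  ultimately show "compact (g ` {s..t})" "connected (g ` {s..t})" "connected (- g ` {s..t})"
    using compact_arc_image connected_arc_image connected_arc_complement[of "subpath s t g"] by force+
qed

lemma arc_image_iff:
  assumes "arc g" "A \<subseteq> {0..1}" "t \<in> {0..1}"
  shows "g t \<in> g ` A \<longleftrightarrow> t \<in> A"
  using assms by (metis arc_def inj_on_image_mem_iff)

lemma arc_mem_iff_endpoint:
  assumes g: "arc g" "path_image g \<inter> K = {pathstart g, pathfinish g}" and u: "u \<in> {0..1}"
  shows "g u \<in> K \<longleftrightarrow> u = 0 \<or> u = 1"
proof -
  have "g u \<in> path_image g" using u by (auto simp: path_image_def)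
  then have "g u \<in> K \<longleftrightarrow> g u = g 0 \<or> g u = g 1" using g(2) by (auto simp: pathstart_def pathfinish_def)
  then show ?thesis using arc_image_iff[OF g(1), of "{0}" u] arc_image_iff[OF g(1), of "{1}" u] u by auto
qed

text \<open>If \<open>x\<close> were off \<open>closure V\<close>, so would be a subarc around it,
  and the frontier of \<open>V\<close> would lie in \<open>M\<close>, which is \<open>K\<close> with
  the two remaining end pieces attached. Each piece meets \<open>K\<close> in one point, so
  \<open>M\<close> does not separate the plane; yet \<open>V\<close> avoids \<open>M\<close> and
  misses \<open>x\<close>.\<close>

lemma crosscut_subset_closure_component:
  assumes K: "compact K" "connected (- K)" and C: "plane_crosscut K C"
    and V: "V \<in> components (- (K \<union> C))" and x: "x \<in> C - K"
  shows "x \<in> closure V"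
proof (rule ccontr)
  assume nx: "x \<notin> closure V"
  obtain g where g: "arc g" "C = path_image g" "C \<inter> K = {pathstart g, pathfinish g}"
    using C plane_crosscut_def by auto
  obtain \<tau> where \<tau>: "\<tau> \<in> {0..1}" "x = g \<tau>" using x g by (auto simp: path_image_def)
  have "\<tau> \<noteq> 0" "\<tau> \<noteq> 1" using \<tau> x g by (auto simp: pathstart_def pathfinish_def)
  then have \<tau>1: "0 < \<tau>" "\<tau> < 1" using \<tau> by auto
  have contg: "continuous_on {0..1} g" using g by (simp add: arc_def path_def)
  obtain e where e: "e > 0" "ball x e \<inter> closure V = {}"
    using nx by (metis closed_closure ComplI Compl_disjoint2 disjoint_eq_subset_Compl open_Compl open_contains_ball)
  obtain d where d: "d > 0" "\<And>t. t \<in> {0..1} \<Longrightarrow> dist t \<tau> < d \<Longrightarrow> dist (g t) (g \<tau>) < e"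
    using contg \<tau> e unfolding continuous_on_iff by metis
  \<comment> \<open>Halving both \<open>d\<close> and the gaps to 0 and 1 keeps \<open>s\<close> and
    \<open>t\<close> strictly between 0 and 1 and the subarc within \<open>ball x e\<close>.\<close>
  define s where "s = max (\<tau>/2) (\<tau> - d/2)"
  define t where "t = min ((\<tau>+1)/2) (\<tau> + d/2)"
  have st: "0 < s" "s < \<tau>" "\<tau> < t" "t < 1" using d(1) \<tau>1 by (auto simp: s_def t_def min_less_iff_disj)
  have mid: "g u \<notin> closure V" if "s \<le> u" "u \<le> t" for u
  proof -
    have "dist u \<tau> < d" using that d st by (auto simp: s_def t_def dist_real_def)
    moreover have "u \<in> {0..1}" using that st by auto
    ultimately have "dist (g u) (g \<tau>) < e" using d by blast
    then have "g u \<in> ball x e" using \<tau> by (simp add: dist_commute)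
    then show ?thesis using e by blast
  qed
  define M where "M = K \<union> g ` {0..s} \<union> g ` {t..1}"
  note endpts = arc_mem_iff_endpoint[OF g(1) g(3)[unfolded g(2)]]
  have 1: "connected (- (K \<union> g ` {0..s}))"
  proof (rule Janiszewski_connected)
    have "g u = g 0" if "u \<in> {0..s}" "g u \<in> K" for u using endpts[of u] st that by auto
    moreover have "g 0 \<in> K" "0 \<in> {0..s}" using endpts[of 0] st by auto
    ultimately have "K \<inter> g ` {0..s} = {g 0}" by blast
    then show "connected (K \<inter> g ` {0..s})" by simp
  qed (use K arc_image_Icc[OF g(1), of 0 s] st in \<open>auto simp: compact_imp_closed\<close>)
  have 2: "connected (- M)" unfolding M_def
  proof (rule Janiszewski_connected)
    have "g u = g 1" if "u \<in> {t..1}" "g u \<in> K" for u using endpts[of u] st that by auto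
    moreover have "g 1 \<in> K" "1 \<in> {t..1}" using endpts[of 1] st by auto
    ultimately have "K \<inter> g ` {t..1} = {g 1}" by blast
    moreover have "g u \<notin> g ` {t..1}" if "u \<in> {0..s}" for u
      using st arc_image_iff[OF g(1), of "{t..1}" u] that by auto
    then have "g ` {0..s} \<inter> g ` {t..1} = {}" by blast
    ultimately have "(K \<union> g ` {0..s}) \<inter> g ` {t..1} = {g 1}" by auto
    then show "connected ((K \<union> g ` {0..s}) \<inter> g ` {t..1})" by simp
  qed (use K 1 arc_image_Icc[OF g(1), of 0 s] arc_image_Icc[OF g(1), of t 1] st in \<open>auto simp: compact_imp_closed compact_Un\<close>)
  have "C = g ` {0..s} \<union> g ` {s..t} \<union> g ` {t..1}"
    using st unfolding g path_image_def image_Un[symmetric] by (intro arg_cong[where f="image g"]) auto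
  then have CM: "K \<union> C = M \<union> g ` {s..t}" by (auto simp: M_def)
  have clo: "closed (K \<union> C)" using K plane_crosscut_compact[OF C] by (simp add: closed_Un compact_imp_closed)
  have opV: "open V" by (rule open_components[OF open_Compl[OF clo] V])
  have "frontier V \<subseteq> K \<union> C"
    by (rule frontier_components_Compl_subset[OF clo V])
  moreover have "frontier V \<subseteq> closure V" by (auto simp: frontier_def)
  moreover have "g ` {s..t} \<inter> closure V = {}" using mid by auto
  ultimately have "frontier V \<subseteq> M" using CM by blast
  moreover have "V \<subseteq> - M" using in_components_subset[OF V] CM by auto
  moreover have "V \<noteq> {}" using in_components_nonempty V by auto
  moreover have "x \<in> - M" "x \<notin> V"
    using endpts[of \<tau>] \<tau> st arc_image_iff[OF g(1), of "{0..s}" \<tau>] arc_image_iff[OF g(1), of "{t..1}" \<tau>] nx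
      closure_subset[of V]
    by (auto simp: M_def)
  ultimately show False using connected_Int_frontier[OF 2, of V] by blast
qed

lemma outside_in_components_Un:
  assumes "compact K" "compact C"
  shows "outside (K \<union> C) \<in> components (- (K \<union> C :: complex set))"
proof -
  have "bounded (K \<union> C)" using assms by (simp add: compact_imp_bounded)
  then show ?thesis using connected_outside outside_bounded_nonempty outside_in_components
    by (metis DIM_complex order_refl)
qed

text \<open>Three complementary components, all adjacent to three disjoint subarcs of the crosscut, would
  contradict three_continua_three_regions.\<close>

lemma connected_inside_crosscut:
  assumes K: "compact K" "connected (- K)" and C: "plane_crosscut K C"
  shows "connected (inside (K \<union> C))"
proof (rule ccontr)
  assume "\<not> connected (inside (K \<union> C))"
  then obtain x y where xy: "x \<in> inside (K \<union> C)" "y \<in> inside (K \<union> C)" "\<not> connected_component (inside (K \<union> C)) x y"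
    using connected_iff_connected_component by metis
  have nc: "\<not> connected_component (- (K \<union> C)) x y"
  proof
    assume "connected_component (- (K \<union> C)) x y"
    then obtain T where T: "connected T" "T \<subseteq> - (K \<union> C)" "x \<in> T" "y \<in> T" by (auto simp: connected_component_def)
    have "T \<subseteq> inside (K \<union> C)"
    proof
      fix z assume "z \<in> T"
      then have "connected_component (- (K \<union> C)) x z" using T connected_component_def by blast
      then show "z \<in> inside (K \<union> C)" using inside_same_component xy by blast
    qed
    then show False using T xy connected_component_def by blast
  qed
  obtain g where g: "arc g" "C = path_image g" "C \<inter> K = {pathstart g, pathfinish g}"
    using C plane_crosscut_def by auto
  have cC: "compact C" using plane_crosscut_compact C .
  \<comment> \<open>Two components inside already give three in all, the outside being the
    third.\<close>
  define V where "V i = (if i = 0 then connected_component_set (- (K \<union> C)) x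
     else if i = 1 then connected_component_set (- (K \<union> C)) y else outside (K \<union> C))" for i :: nat
  \<comment> \<open>The parameter intervals [1/8, 2/8], [3/8, 4/8] and [5/8, 6/8] are disjoint and
    stay away from 0 and 1, where the arc meets \<open>K\<close>.\<close>
  define X where "X i = g ` {(2 * real i + 1)/8 .. (2 * real i + 2)/8}" for i
  have xyK: "x \<in> - (K \<union> C)" "y \<in> - (K \<union> C)" using xy inside_no_overlap[of "K \<union> C"] by blast+
  have Vcomp: "V i \<in> components (- (K \<union> C))" for i
    using outside_in_components_Un[OF K(1) cC] xyK by (auto simp: V_def components_def simp del: Compl_Un)
  have V_ne: "V 0 \<noteq> V 1" "V 0 \<noteq> V 2" "V 1 \<noteq> V 2"
  proof -
    have "x \<notin> outside (K \<union> C)" "y \<notin> outside (K \<union> C)"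
      using xy inside_Int_outside[of "K \<union> C"] by blast+
    then have "x \<in> V 0" "y \<in> V 1" "x \<notin> V 2" "y \<notin> V 2" "y \<notin> V 0"
      using nc xyK
      by (auto simp: V_def connected_component_refl_eq simp del: Compl_Un)
    then show "V 0 \<noteq> V 1" "V 0 \<noteq> V 2" "V 1 \<noteq> V 2" by auto
  qed
  note endpts = arc_mem_iff_endpoint[OF g(1) g(3)[unfolded g(2)]]
  have clo: "closed (K \<union> C)" using K cC by (simp add: closed_Un compact_imp_closed)
  show False
  proof (rule three_continua_three_regions[of X V])
    fix i :: nat assume i: "i < 3"
    show "compact (X i)" "connected (X i)" "connected (- X i)"
      using arc_image_Icc[OF g(1), of "(2 * real i + 1)/8" "(2 * real i + 2)/8"] i by (auto simp: X_def)
    show "open (V i)" by (rule open_components[OF open_Compl[OF clo] Vcomp])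
    show "connected (V i)" using in_components_connected Vcomp by auto
  next
    fix i j :: nat assume ij: "i < j" "j < 3"
    show "V i \<inter> V j = {}"
    proof -
      have "i = 0 \<and> j = 1 \<or> i = 0 \<and> j = 2 \<or> i = 1 \<and> j = 2" using ij by linarith
      then have "V i \<noteq> V j" using V_ne by blast
      then show ?thesis using components_nonoverlap[OF Vcomp Vcomp] by blast
    qed
    show "X i \<inter> X j = {}"
    proof (rule ccontr)
      assume "X i \<inter> X j \<noteq> {}"
      then obtain a b where ab: "g a = g b" "a \<in> {(2 * real i + 1)/8 .. (2 * real i + 2)/8}"
        "b \<in> {(2 * real j + 1)/8 .. (2 * real j + 2)/8}" unfolding X_def by blast
      have "real i + 1 \<le> real j" "real j \<le> 2" using ij by auto
      with ab have "a < b" "a \<in> {0..1}" "b \<in> {0..1}" by auto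
      then show False using g(1) ab(1) unfolding arc_def inj_on_def by fastforce
    qed
  next
    fix i j :: nat assume ij: "i < 3" "j < 3"
    have "X j \<subseteq> C" using ij by (auto simp: X_def g(2) path_image_def)
    then show "V i \<inter> X j = {}" using in_components_subset[OF Vcomp[of i]] by blast
    \<comment> \<open>\<open>s\<close> is the midpoint of the parameter interval of
      \<open>X j\<close>. Near \<open>c = g s\<close> the set \<open>K \<union> C\<close> consists
      of points of \<open>X j\<close> only, and every \<open>V i\<close> comes arbitrarily close to
      \<open>c\<close>.\<close>
    define r s t where "r = (2 * real j + 1)/8" and "s = (4 * real j + 3)/16" and "t = (2 * real j + 2)/8"
    have rst: "0 < r" "r < s" "s < t" "t < 1" using ij by (auto simp: r_def s_def t_def)
    define c where "c = g s"
    have "c \<notin> K \<union> g ` {0..r} \<union> g ` {t..1}"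
      using endpts[of s] arc_image_iff[OF g(1), of "{0..r}" s] arc_image_iff[OF g(1), of "{t..1}" s] rst
      by (auto simp: c_def)
    moreover have "closed (K \<union> g ` {0..r} \<union> g ` {t..1})"
      using arc_image_Icc[OF g(1), of 0 r] arc_image_Icc[OF g(1), of t 1] K rst
      by (auto simp: closed_Un compact_imp_closed)
    ultimately obtain e where e: "e > 0" "ball c e \<inter> (K \<union> g ` {0..r} \<union> g ` {t..1}) = {}"
      by (metis ComplI Compl_disjoint2 disjoint_eq_subset_Compl open_Compl open_contains_ball)
    have "C = g ` {0..r} \<union> X j \<union> g ` {t..1}"
      using rst unfolding g path_image_def X_def image_Un[symmetric] r_def[symmetric] t_def[symmetric]
      by (intro arg_cong[where f="image g"]) auto
    then have B: "ball c e \<inter> (K \<union> C) \<subseteq> X j" using e by blast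
    have cC: "c \<in> C - K" using endpts[of s] rst by (auto simp: c_def g path_image_def)
    show "accessible_from (V i) (X j)"
    proof (rule accessible_fromI[of _ "K \<union> C" "ball c e" _ c])
      show "open (V i)" by (rule open_components[OF open_Compl[OF clo] Vcomp])
      show "frontier (V i) \<subseteq> K \<union> C"
        by (rule frontier_components_Compl_subset[OF clo Vcomp])
      have "c \<in> closure (V i)"
        using crosscut_subset_closure_component[OF K C Vcomp cC] .
      then show "V i \<inter> ball c e \<noteq> {}" using e
        by (meson centre_in_ball disjoint_iff open_Int_closure_eq_empty open_ball)
      show "c \<notin> V i" using in_components_subset[OF Vcomp[of i]] cC by auto
    qed (use B e in auto)
  qed
qed

text \<open>Otherwise \<open>K \<union> C\<close> would not separate the plane, and the dual of
  Janiszewski's theorem would make the two-point set \<open>K \<inter> C\<close> connected.\<close>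

lemma inside_crosscut_nonempty:
  assumes K: "compact K" "connected K" and C: "plane_crosscut K C"
  shows "inside (K \<union> C) \<noteq> {}"
proof
  assume "inside (K \<union> C) = {}"
  then have "outside (K \<union> C) = - (K \<union> C)" using inside_Un_outside by blast
  then have "connected (- (K \<union> C))"
    using connected_outside[of "K \<union> C"] K plane_crosscut_compact[OF C] by (simp add: compact_imp_bounded)
  then have "connected (K \<inter> C)"
    using Janiszewski_dual K plane_crosscut_compact[OF C] plane_crosscut_connected[OF C] by blast
  moreover obtain g where g: "arc g" "C = path_image g" "C \<inter> K = {pathstart g, pathfinish g}"
    using C plane_crosscut_def by auto
  ultimately have "connected {pathstart g, pathfinish g}" by (simp add: Int_commute)
  then show False using arc_distinct_ends[OF g(1)] connected_finite_iff_sing[of "{pathstart g, pathfinish g}"] by auto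
qed

text \<open>Adding \<open>C - K\<close> to the outside of \<open>K \<union> C\<close> keeps it
  connected, since \<open>C - K\<close> lies in the closure of that outside. The result is unbounded
  and misses \<open>K \<union> D\<close>, so \<open>inside (K \<union> D)\<close> cannot meet
  it.\<close>

lemma inside_crosscut_mono:
  assumes K: "compact K" "connected (- K)" and C: "plane_crosscut K C"
    and D: "D - K \<subseteq> inside (K \<union> C)"
  shows "inside (K \<union> D) \<subseteq> inside (K \<union> C)"
proof -
  define Q where "Q = outside (K \<union> C) \<union> (C - K)"
  have cC: "compact C" using plane_crosscut_compact C .
  have bd: "bounded (K \<union> C)" using K cC by (simp add: compact_imp_bounded)
  have "connected Q"
  proof (rule connected_intermediate_closure)
    show "connected (outside (K \<union> C))" using bd by (simp add: connected_outside)
    show "Q \<subseteq> closure (outside (K \<union> C))"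
  using crosscut_subset_closure_component[OF K C outside_in_components_Un[OF K(1) cC]] closure_subset
      by (auto simp: Q_def)
  qed (auto simp: Q_def)
  moreover have "\<not> bounded Q" using unbounded_outside[OF bd] bounded_subset by (auto simp: Q_def)
  moreover have "Q \<subseteq> - (K \<union> D)"
    using D inside_Int_outside[of "K \<union> C"] outside_no_overlap[of "K \<union> C"] inside_no_overlap[of "K \<union> C"]
    unfolding Q_def by blast
  ultimately have "inside (K \<union> D) \<subseteq> - (K \<union> D) - Q" using inside_subset[of Q "- (K \<union> D) - Q" "K \<union> D"] by blast
  then show ?thesis using inside_Un_outside[of "K \<union> C"] unfolding Q_def by blast
qed

section \<open>Chains of crosscuts\<close>

text \<open>Connectedness im kleinen: the local connectivity of the theorem, with balls for
  neighbourhoods. \<open>X\<close> need not be open in \<open>K\<close>.\<close>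

definition im_kleinen_at :: "'a::metric_space set \<Rightarrow> 'a \<Rightarrow> bool" where
  "im_kleinen_at K z \<longleftrightarrow> z \<in> K \<and>
    (\<forall>e>0. \<exists>d>0. \<exists>X. connected X \<and> X \<subseteq> K \<inter> ball z e \<and> K \<inter> ball z d \<subseteq> X)"

lemma connected_subset_inside:
  "connected T \<Longrightarrow> T \<subseteq> - S \<Longrightarrow> x \<in> T \<Longrightarrow> x \<in> inside S \<Longrightarrow> T \<subseteq> inside S"
  by (meson connected_component_of_subset connected_component_def inside_same_component subsetI)

lemma connected_subset_outside:
  "connected T \<Longrightarrow> T \<subseteq> - S \<Longrightarrow> x \<in> T \<Longrightarrow> x \<in> outside S \<Longrightarrow> T \<subseteq> outside S"
  by (meson connected_component_of_subset connected_component_def outside_same_component subsetI)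

lemma plane_crosscut_meets:
  assumes "plane_crosscut K C" obtains k where "k \<in> K" "k \<in> C"
  using assms unfolding plane_crosscut_def by blast

text \<open>Holes of subsets of \<open>K\<close> can thus be filled without leaving
  \<open>K\<close>: the connected unbounded set \<open>- K\<close> cannot enter a hole of
  \<open>X\<close>.\<close>

lemma inside_subset_of_connected_Compl:
  fixes X K :: "complex set"
  assumes "X \<subseteq> K" "bounded K" "connected (- K)"
  shows "inside X \<subseteq> K"
proof -
  have "\<not> bounded (- K)" using assms cobounded_imp_unbounded[of "- K"] by simp
  then show ?thesis using inside_subset[of "- K" "K - X" X] assms by auto
qed

text \<open>A prime end sequence seen from a base point at infinity, so that
  \<open>inside (K \<union> C n)\<close> stands for U_{C_n}. Smallness is stated for pairs of
  points, the form that uniform continuity transports.\<close>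

locale plane_crosscut_chain =
  fixes K :: "complex set" and C :: "nat \<Rightarrow> complex set"
  assumes K: "compact K" "connected K" "connected (- K)"
    and C: "\<And>n. plane_crosscut K (C n)"
    and disjC: "\<And>n. C n \<inter> C (Suc n) = {}"
    and chain: "\<And>n. C (Suc n) \<subseteq> closure (inside (K \<union> C n))"
    and small: "\<And>e. e > 0 \<Longrightarrow> \<forall>\<^sub>F n in sequentially. \<forall>x \<in> C n. \<forall>y \<in> C n. dist x y < e"
begin

lemma closed_KC: "closed (K \<union> C n)"
  using K plane_crosscut_compact[OF C] by (simp add: closed_Un compact_imp_closed)

lemma bounded_KC: "bounded (K \<union> C n)"
  using K plane_crosscut_compact[OF C] by (simp add: compact_imp_bounded)

text \<open>The closure in \<open>chain\<close> adds only points of \<open>K\<close> and of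
  \<open>C n\<close>, and disjointness excludes the latter.\<close>

lemma next_crosscut: "C (Suc n) - K \<subseteq> inside (K \<union> C n)"
  using chain[of n] disjC[of n] closure_inside_subset[OF closed_KC[of n]] by blast

lemma inside_antimono: "n \<le> m \<Longrightarrow> inside (K \<union> C m) \<subseteq> inside (K \<union> C n)"
proof (induction m rule: dec_induct)
  case (step m)
  have "inside (K \<union> C (Suc m)) \<subseteq> inside (K \<union> C m)"
    using inside_crosscut_mono[OF K(1,3) C next_crosscut] .
  then show ?case using step by blast
qed simp

text \<open>Extend \<open>P\<close> by a path off \<open>K\<close> to a far point. The resulting
  compact set has positive distance from \<open>K\<close>, whereas every crosscut meets
  \<open>K\<close> and late ones are short; so they miss that set and cannot cut it off from
  infinity.\<close>

lemma eventually_outside: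
  assumes P: "compact P" "connected P" "P \<inter> K = {}"
  shows "\<forall>\<^sub>F n in sequentially. P \<subseteq> outside (K \<union> C n)"
proof (cases "P = {}")
  case False
  then obtain p where p: "p \<in> P" by blast
  obtain R where R: "R > 0" "K \<subseteq> ball 0 R"
    using K(1) by (meson bounded_subset_ballD compact_imp_bounded)
  \<comment> \<open>A crosscut of diameter below 1 that meets \<open>K\<close> stays in
    \<open>ball 0 (R + 1)\<close>, so a point of norm \<open>R + 2\<close> is outside.\<close>
  define a :: complex where "a = of_real (R + 2)"
  have na: "norm a = R + 2" using R unfolding a_def norm_of_real by simp
  then have "a \<in> - K" "p \<in> - K" using R p P by (auto simp: subset_iff)
  moreover have "path_connected (- K)"
    using K by (simp add: connected_open_path_connected compact_imp_closed open_Compl)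
  ultimately obtain q where q: "path q" "path_image q \<subseteq> - K" "pathstart q = p" "pathfinish q = a"
    unfolding path_connected_def by metis
  define Q where "Q = P \<union> path_image q"
  have Q: "compact Q" "a \<in> Q" "Q \<inter> K = {}"
    using P q pathfinish_in_path_image[of q] by (auto simp: Q_def compact_Un compact_path_image)
  have cQ: "connected Q" unfolding Q_def
    by (rule connected_Un) (use P q p pathstart_in_path_image[of q] in \<open>auto simp: connected_path_image\<close>)
  obtain d where d: "d > 0" "\<And>x y. x \<in> Q \<Longrightarrow> y \<in> K \<Longrightarrow> d \<le> dist x y"
    using separate_compact_closed[OF Q(1) compact_imp_closed[OF K(1)] Q(3)] by blast
  have "\<forall>\<^sub>F n in sequentially. \<forall>x \<in> C n. \<forall>y \<in> C n. dist x y < min d 1"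
    by (rule small) (use d in simp)
  then show ?thesis
  proof eventually_elim
    case (elim n)
    obtain k where k: "k \<in> K" "k \<in> C n" using plane_crosscut_meets[OF C] by blast
    have "Q \<inter> C n = {}" using d(2) k elim by force
    then have QKC: "Q \<subseteq> - (K \<union> C n)" using Q by blast
    have "norm x < R + 1" if "x \<in> C n" for x
    proof -
      have "dist x k < 1" using elim k that by auto
      moreover have "norm k < R" using k R by (auto simp: subset_iff)
      ultimately show ?thesis using norm_triangle_sub[of x k] by (simp add: dist_norm)
    qed
    then have "K \<union> C n \<subseteq> ball 0 (R + 1)" using R(2) by (force simp: subset_iff)
    then have "- ball 0 (R + 1) \<subseteq> outside (K \<union> C n)" using outside_subset_convex convex_ball by blast
    then have "a \<in> outside (K \<union> C n)" using na by auto
    then have "Q \<subseteq> outside (K \<union> C n)" using connected_subset_outside[OF cQ QKC Q(2)] by blast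
    then show ?case by (auto simp: Q_def)
  qed
qed simp

text \<open>Local connectivity joins the two endpoints of a small crosscut \<open>C n\<close> near \<open>z\<close> inside \<open>K\<close> by a
  small continuum \<open>Y\<close>.  As \<open>K \<inter> (C n \<union> Y) = Y\<close> is connected and \<open>K\<close> does not separate, Janiszewski's
  theorem shows that the small set \<open>C n \<union> Y\<close> already cuts off the inside.\<close>

lemma cluster_point_unique:
  assumes z: "im_kleinen_at K z"
    and cluster: "\<And>d. d > 0 \<Longrightarrow> \<exists>\<^sub>F n in sequentially. C n \<inter> ball z d \<noteq> {}"
    and w: "\<And>n. w \<in> closure (inside (K \<union> C n))"
  shows "w = z"
proof -
  have "dist z w \<le> e" if e: "e > 0" for e
  proof -
    obtain d X where d: "d > 0" "connected X" "X \<subseteq> K \<inter> ball z e" "K \<inter> ball z d \<subseteq> X"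
      using z e unfolding im_kleinen_at_def by blast
    \<comment> \<open>A crosscut that meets \<open>ball z d'\<close> and has all mutual distances
      below \<open>d'\<close> lies in both \<open>ball z d\<close> and
      \<open>ball z e\<close>.\<close>
    define d' where "d' = min d e / 2"
    have "d' > 0" using d e by (simp add: d'_def)
    then have "\<exists>\<^sub>F n in sequentially. C n \<inter> ball z d' \<noteq> {} \<and> (\<forall>x \<in> C n. \<forall>y \<in> C n. dist x y < d')"
      using frequently_eventually_conj[OF cluster small] by (simp add: conj_commute)
    then obtain n where n: "C n \<inter> ball z d' \<noteq> {}" "\<And>x y. x \<in> C n \<Longrightarrow> y \<in> C n \<Longrightarrow> dist x y < d'"
      using frequently_ex by fastforce
    then obtain c where c: "c \<in> C n" "dist z c < d'" by auto
    have "dist z x < min d e" if "x \<in> C n" for x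
      using dist_triangle[of z x c] n(2)[OF c(1) that] c(2) by (simp add: d'_def)
    then have Cn: "C n \<subseteq> ball z d" "C n \<subseteq> ball z e" by auto
    define Y where "Y = closure X"
    have Y: "connected Y" "Y \<subseteq> K" "Y \<subseteq> cball z e"
    proof -
      show "connected Y" using d by (simp add: Y_def connected_imp_connected_closure)
      show "Y \<subseteq> K" unfolding Y_def using d K by (intro closure_minimal) (auto simp: compact_imp_closed)
      show "Y \<subseteq> cball z e" unfolding Y_def using d by (intro closure_minimal) auto
    qed
    \<comment> \<open>\<open>C n\<close> lies in \<open>ball z d\<close>, so it meets
      \<open>K\<close> only within \<open>X\<close>.\<close>
    have KT: "K \<inter> (C n \<union> Y) = Y" "K \<union> (C n \<union> Y) = K \<union> C n"
      using Y d Cn closure_subset[of X] by (auto simp: Y_def)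
    have "inside (K \<union> C n) \<subseteq> cball z e"
    proof
      fix p assume p: "p \<in> inside (K \<union> C n)"
      show "p \<in> cball z e"
      proof (rule ccontr)
        assume pz: "p \<notin> cball z e"
        have "\<not> outside (K \<union> C n) \<subseteq> cball z e"
          using unbounded_outside[OF bounded_KC] bounded_subset bounded_cball by blast
        then obtain a where a: "a \<in> outside (K \<union> C n)" "a \<notin> cball z e" by blast
        have "p \<in> - K" "a \<in> - K" using p a(1) inside_no_overlap outside_no_overlap by blast+
        then have 1: "connected_component (- K) p a"
          using K(3) connected_component_def by blast
        have "connected (- cball z e)"
          by (rule connected_complement_bounded_convex) auto
        moreover have "- cball z e \<subseteq> - (C n \<union> Y)" using Cn(2) Y(3) ball_subset_cball[of z e] by blast
        ultimately have 2: "connected_component (- (C n \<union> Y)) p a"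
          using pz a(2) unfolding connected_component_def by blast
        have "closed (C n \<union> Y)" using plane_crosscut_compact[OF C] by (simp add: Y_def closed_Un compact_imp_closed)
        then have "connected_component (- (K \<union> (C n \<union> Y))) p a"
          using Janiszewski[OF K(1) _ _ 1 2] Y(1) KT by simp
        then have "connected_component (- (K \<union> C n)) p a" using KT by simp
        then have "a \<in> inside (K \<union> C n)" using p inside_same_component by blast
        then show False using a inside_Int_outside by blast
      qed
    qed
    then have "closure (inside (K \<union> C n)) \<subseteq> cball z e" by (intro closure_minimal) auto
    then show ?thesis using w[of n] by auto
  qed
  then show ?thesis by (metis dist_eq_0_iff dist_commute dist_le_zero_iff field_le_epsilon add.left_neutral)
qed

text \<open>Points of \<open>inside (K \<union> C n)\<close> near the three \<open>z i\<close> are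
  joined by a compact connected \<open>P\<close> in this connected open set. By
  \<open>eventually_outside\<close> some later crosscut leaves \<open>P\<close> outside, so a single
  component between the two crosscuts contains all of \<open>P\<close>.\<close>

lemma region_between:
  assumes B: "\<And>i. i < 3 \<Longrightarrow> open (B i)" "\<And>i. i < 3 \<Longrightarrow> z i \<in> B i"
    and z: "\<And>i n. i < 3 \<Longrightarrow> z i \<in> closure (inside (K \<union> C n))"
  obtains m V where "m > n" "V \<in> components (- (K \<union> C n \<union> C m))" "V \<subseteq> inside (K \<union> C n)"
    "V \<inter> inside (K \<union> C m) = {}" "\<And>i::nat. i < 3 \<Longrightarrow> V \<inter> B i \<noteq> {}"
proof -
  let ?I = "inside (K \<union> C n)"
  have "?I \<inter> B i \<noteq> {}" if "i < 3" for i
    using that B z[of i n] open_Int_closure_eq_empty[of "B i" ?I] by blast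
  then have "\<forall>i. \<exists>x. i < 3 \<longrightarrow> x \<in> ?I \<inter> B i" by blast
  then obtain u where u: "\<And>i. i < 3 \<Longrightarrow> u i \<in> ?I \<inter> B i" by metis
  have "path_connected ?I"
    using connected_inside_crosscut[OF K(1,3) C] open_inside[OF closed_KC] connected_open_path_connected by blast
  then have "\<exists>p. path p \<and> path_image p \<subseteq> ?I \<and> pathstart p = u 0 \<and> pathfinish p = u i" if "i < 3" for i
    using u[of 0] u[OF that] unfolding path_connected_def by simp
  then obtain p where p: "\<And>i. i < 3 \<Longrightarrow> path (p i) \<and> path_image (p i) \<subseteq> ?I \<and> pathstart (p i) = u 0 \<and> pathfinish (p i) = u i"
    by metis
  define P where "P = (\<Union>i<3. path_image (p i))"
  have u0P: "u 0 \<in> path_image (p i)" if "i < 3" for i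
    using p[OF that] pathstart_in_path_image[of "p i"] by auto
  have uP: "u i \<in> P" if "i < 3" for i
    using p[OF that] pathfinish_in_path_image[of "p i"] that by (auto simp: P_def)
  have P: "compact P" "P \<subseteq> ?I"
    using p by (auto simp: P_def compact_path_image intro!: compact_UN)
  have cP: "connected P" unfolding P_def
  proof (rule connected_Union)
    have "u 0 \<in> (\<Inter>i<3. path_image (p i))" using u0P by blast
    then show "(\<Inter>i<3. path_image (p i)) \<noteq> {}" by blast
  qed (use p in \<open>auto simp: connected_path_image\<close>)
  have "P \<inter> K = {}" "P \<inter> C n = {}" using P inside_no_overlap[of "K \<union> C n"] by blast+
  then have "\<forall>\<^sub>F m in sequentially. P \<subseteq> outside (K \<union> C m) \<and> m > n"
    using eventually_outside[OF P(1) cP] eventually_gt_at_top[of n] by (simp add: eventually_conj)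
  then obtain m where m: "P \<subseteq> outside (K \<union> C m)" "m > n"
    by (metis (mono_tags, lifting) eventually_sequentially order_refl)
  define V where "V = connected_component_set (- (K \<union> C n \<union> C m)) (u 0)"
  have Psub: "P \<subseteq> - (K \<union> C n \<union> C m)"
    using m(1) P(2) inside_no_overlap[of "K \<union> C n"] outside_no_overlap[of "K \<union> C m"] by blast
  have PV: "P \<subseteq> V" unfolding V_def by (rule connected_component_maximal) (use uP cP Psub in auto)
  have Vsub: "V \<subseteq> - (K \<union> C n \<union> C m)" unfolding V_def by (rule connected_component_subset)
  have cV: "connected V" by (simp add: V_def)
  have u0: "u 0 \<in> V" using PV uP by auto
  show thesis
  proof (rule that[of m V])
    show "m > n" by fact
    show "V \<in> components (- (K \<union> C n \<union> C m))"
      unfolding V_def by (rule componentsI) (use Psub uP[of 0] in auto)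
    show "V \<subseteq> ?I" by (rule connected_subset_inside[OF cV _ u0]) (use Vsub u[of 0] in auto)
    have "V \<subseteq> outside (K \<union> C m)"
      by (rule connected_subset_outside[OF cV _ u0]) (use Vsub m uP[of 0] in auto)
    then show "V \<inter> inside (K \<union> C m) = {}" using inside_Int_outside by blast
    show "V \<inter> B i \<noteq> {}" if "i < 3" for i using u[OF that] uP[OF that] PV by auto
  qed
qed

lemma no_three_im_kleinen_points:
  assumes z: "\<And>i. i < 3 \<Longrightarrow> im_kleinen_at K (z i)" "inj_on z {..<3::nat}"
    and cl: "\<And>i n. i < 3 \<Longrightarrow> z i \<in> closure (inside (K \<union> C n))"
  shows False
proof -
  \<comment> \<open>If crosscuts accumulated at one \<open>z i\<close>, then
    \<open>cluster_point_unique\<close> would force all three points to coincide.\<close>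
  have "\<exists>d>0. \<forall>\<^sub>F n in sequentially. C n \<inter> ball (z i) d = {}" if i: "i < 3" for i
  proof (rule ccontr)
    assume "\<not> ?thesis"
    then have "\<exists>\<^sub>F n in sequentially. C n \<inter> ball (z i) d \<noteq> {}" if "d > 0" for d
      using that by (auto simp: frequently_def)
    then have "z j = z i" if "j < 3" for j
      using cluster_point_unique[OF z(1)[OF i]] cl[OF that] by blast
    then have "z 0 = z 1" by simp
    then show False using inj_onD[OF z(2), of 0 1] by simp
  qed
  then obtain r where r: "\<And>i. i < 3 \<Longrightarrow> r i > 0"
      "\<And>i. i < 3 \<Longrightarrow> \<forall>\<^sub>F n in sequentially. C n \<inter> ball (z i) (r i) = {}"
    by metis
  have "\<forall>\<^sub>F n in sequentially. \<forall>i\<in>{..<3}. C n \<inter> ball (z i) (r i) = {}"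
    by (rule eventually_ball_finite) (use r in auto)
  then obtain N where N: "\<And>n i. n \<ge> N \<Longrightarrow> i < 3 \<Longrightarrow> C n \<inter> ball (z i) (r i) = {}"
    unfolding eventually_sequentially by blast
  define D where "D = min (dist (z 0) (z 1)) (min (dist (z 0) (z 2)) (dist (z 1) (z 2)))"
  have "z 0 \<noteq> z 1" "z 0 \<noteq> z 2" "z 1 \<noteq> z 2"
    using inj_on_eq_iff[OF z(2), of 0 1] inj_on_eq_iff[OF z(2), of 0 2] inj_on_eq_iff[OF z(2), of 1 2] by simp_all
  then have D: "D > 0" by (simp add: D_def)
  have Dij: "D \<le> dist (z i) (z j)" if "i < j" "j < 3" for i j
  proof -
    have "i = 0 \<and> j = 1 \<or> i = 0 \<and> j = 2 \<or> i = 1 \<and> j = 2" using that by linarith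
    then show ?thesis by (auto simp: D_def)
  qed
  \<comment> \<open>Closed discs of radius \<open>D/3\<close> about the \<open>z i\<close> are
    disjoint, their centres being at least \<open>D\<close> apart.\<close>
  have "\<exists>d>0. \<exists>X. connected X \<and> X \<subseteq> K \<inter> ball (z i) (D/3) \<and> K \<inter> ball (z i) d \<subseteq> X" if "i < 3" for i
  proof -
    have "D/3 > 0" using D by simp
    then show ?thesis using z(1)[OF that] unfolding im_kleinen_at_def by blast
  qed
  then obtain d X where d: "\<And>i. i < 3 \<Longrightarrow> d i > 0" and X: "\<And>i. i < 3 \<Longrightarrow> connected (X i)"
    "\<And>i. i < 3 \<Longrightarrow> X i \<subseteq> K \<inter> ball (z i) (D/3)" "\<And>i. i < 3 \<Longrightarrow> K \<inter> ball (z i) (d i) \<subseteq> X i"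
    by metis
  \<comment> \<open>Within distance \<open>d i\<close> all of \<open>K\<close> belongs to
    \<open>X i\<close>, and within \<open>r i\<close> there is no late crosscut. So inside
    \<open>B i\<close> the frontier of a region between late crosscuts lies in
    \<open>X i\<close>.\<close>
  define B where "B i = ball (z i) (min (d i) (r i))" for i
  have B: "open (B i)" "z i \<in> B i" "convex (B i)" if "i < 3" for i
    using d[OF that] r(1)[OF that] by (auto simp: B_def)
  \<comment> \<open>Filling the holes makes the continuum non-separating, and the convex disc around
    it still contains the result.\<close>
  define Y where "Y i = closure (X i) \<union> inside (closure (X i))" for i
  have XK: "closure (X i) \<subseteq> K" if "i < 3" for i
    using X(2)[OF that] K by (intro closure_minimal) (auto simp: compact_imp_closed)
  have YK: "Y i \<subseteq> K" if "i < 3" for i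
    using XK[OF that] inside_subset_of_connected_Compl[OF XK[OF that]] K by (auto simp: Y_def compact_imp_bounded)
  have Ycball: "Y i \<subseteq> cball (z i) (D/3)" if "i < 3" for i
  proof -
    have "closure (X i) \<subseteq> cball (z i) (D/3)" using X(2)[OF that] by (intro closure_minimal) auto
    then have "- cball (z i) (D/3) \<subseteq> outside (closure (X i))" by (intro outside_subset_convex) auto
    then show ?thesis unfolding Y_def union_with_inside by blast
  qed
  \<comment> \<open>Each region lies in the inside of the crosscut where the previous one stops, and
    the previous one misses that inside; hence disjointness. Starting from \<open>N\<close> keeps
    all bounding crosscuts away from the \<open>B i\<close>.\<close>
  obtain n1 V0 where V0: "n1 > N" "V0 \<in> components (- (K \<union> C N \<union> C n1))" "V0 \<subseteq> inside (K \<union> C N)"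
    "V0 \<inter> inside (K \<union> C n1) = {}" "\<And>i. i < 3 \<Longrightarrow> V0 \<inter> B i \<noteq> {}"
    by (rule region_between[of B z N]) (use B cl in auto)
  obtain n2 V1 where V1: "n2 > n1" "V1 \<in> components (- (K \<union> C n1 \<union> C n2))" "V1 \<subseteq> inside (K \<union> C n1)"
    "V1 \<inter> inside (K \<union> C n2) = {}" "\<And>i. i < 3 \<Longrightarrow> V1 \<inter> B i \<noteq> {}"
    by (rule region_between[of B z n1]) (use B cl in auto)
  obtain n3 V2 where V2: "n3 > n2" "V2 \<in> components (- (K \<union> C n2 \<union> C n3))" "V2 \<subseteq> inside (K \<union> C n2)"
    "V2 \<inter> inside (K \<union> C n3) = {}" "\<And>i. i < 3 \<Longrightarrow> V2 \<inter> B i \<noteq> {}"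
    by (rule region_between[of B z n2]) (use B cl in auto)
  define V where "V i = (if i = 0 then V0 else if i = 1 then V1 else V2)" for i :: nat
  have Vcomp: "\<exists>n\<ge>N. \<exists>m\<ge>N. V i \<in> components (- (K \<union> C n \<union> C m))" for i
  proof -
    have "N \<le> N" "N \<le> n1" "N \<le> n2" "N \<le> n3" using V0(1) V1(1) V2(1) by auto
    then show ?thesis using V0(2) V1(2) V2(2) by (auto simp: V_def simp del: Compl_Un)
  qed
  have VB: "V i \<inter> B j \<noteq> {}" if "j < 3" for i j
    using V0(5)[OF that] V1(5)[OF that] V2(5)[OF that] by (simp add: V_def)
  have VK: "V i \<inter> K = {}" for i
    using Vcomp[of i] in_components_subset by blast
  have clo: "closed (K \<union> C n \<union> C m)" for n m
    using closed_KC plane_crosscut_compact[OF C] by (simp add: closed_Un compact_imp_closed)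
  show False
  proof (rule three_continua_three_regions[of Y V])
    fix i :: nat assume i: "i < 3"
    have "bounded (closure (X i))" using XK[OF i] K bounded_subset compact_imp_bounded by blast
    then show "connected (- Y i)" unfolding Y_def union_with_inside double_complement
      by (intro connected_outside) auto
    have "closed (Y i)" unfolding Y_def union_with_inside by (intro closed_Compl open_outside closed_closure)
    then have "compact (K \<inter> Y i)" using K by (simp add: compact_Int_closed)
    then show "compact (Y i)" using YK[OF i] by (simp add: Int_absorb1)
    show "connected (Y i)" unfolding Y_def using X(1)[OF i] by (intro connected_with_inside) (auto simp: connected_imp_connected_closure)
    obtain n m where nm: "V i \<in> components (- (K \<union> C n \<union> C m))" using Vcomp by blast
    show "open (V i)" by (rule open_components[OF open_Compl[OF clo] nm])
    show "connected (V i)" using nm in_components_connected by blast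
  next
    fix i j :: nat assume ij: "i < j" "j < 3"
    show "Y i \<inter> Y j = {}"
    proof (rule ccontr)
      assume "Y i \<inter> Y j \<noteq> {}"
      then obtain y where "dist (z i) y \<le> D/3" "dist (z j) y \<le> D/3"
        using Ycball[of i] Ycball[of j] ij by fastforce
      then have "dist (z i) (z j) \<le> 2 * D / 3" using dist_triangle2[of "z i" "z j" y] by simp
      then show False using Dij[OF ij] D by simp
    qed
    have "V0 \<inter> V1 = {}" using V0(4) V1(3) by blast
    moreover have "V0 \<inter> V2 = {}" using V0(4) V2(3) inside_antimono[of n1 n2] V1(1) by auto
    moreover have "V1 \<inter> V2 = {}" using V1(4) V2(3) by blast
    moreover have "i = 0 \<and> j = 1 \<or> i = 0 \<and> j = 2 \<or> i = 1 \<and> j = 2" using ij by linarith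
    ultimately show "V i \<inter> V j = {}" by (auto simp: V_def)
  next
    fix i j :: nat assume ij: "i < 3" "j < 3"
    show "V i \<inter> Y j = {}" using VK[of i] YK[OF ij(2)] by blast
    obtain n m where nm: "n \<ge> N" "m \<ge> N" "V i \<in> components (- (K \<union> C n \<union> C m))" using Vcomp by blast
    show "accessible_from (V i) (Y j)"
    proof (rule accessible_fromI[of _ "K \<union> C n \<union> C m" "B j" _ "z j"])
      show "open (V i)" by (rule open_components[OF open_Compl[OF clo] nm(3)])
      show "frontier (V i) \<subseteq> K \<union> C n \<union> C m" by (rule frontier_components_Compl_subset[OF clo nm(3)])
      have "B j \<subseteq> ball (z j) (d j)" "B j \<subseteq> ball (z j) (r j)" by (auto simp: B_def)
      then have "B j \<inter> (K \<union> C n \<union> C m) \<subseteq> X j"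
        using N[OF nm(1) ij(2)] N[OF nm(2) ij(2)] X(3)[OF ij(2)] by blast
      then show "B j \<inter> (K \<union> C n \<union> C m) \<subseteq> Y j" using closure_subset[of "X j"] by (auto simp: Y_def)
      show "z j \<notin> V i" using VK[of i] z(1)[OF ij(2)] by (auto simp: im_kleinen_at_def)
    qed (use VB B ij in auto)
  qed
qed

lemma im_kleinen_points_at_most_two:
  assumes Z: "\<And>z. z \<in> Z \<Longrightarrow> im_kleinen_at K z" "\<And>z n. z \<in> Z \<Longrightarrow> z \<in> closure (inside (K \<union> C n))"
  shows "finite Z \<and> card Z \<le> 2"
proof (rule ccontr)
  assume "\<not> ?thesis"
  then have "infinite Z \<or> 3 \<le> card Z" by linarith
  then obtain T where T: "T \<subseteq> Z" "finite T" "card T = 3"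
    using infinite_arbitrarily_large[of Z 3] obtain_subset_with_card_n[of 3 Z] by metis
  obtain f where f: "bij_betw f {0..<3::nat} T" using ex_bij_betw_nat_finite[OF T(2)] T(3) by auto
  have "\<And>i. i < 3 \<Longrightarrow> f i \<in> Z" using f T(1) by (auto simp: bij_betw_def)
  moreover have "inj_on f {..<3}" using f by (simp add: bij_betw_def lessThan_atLeast0)
  ultimately show False using no_three_im_kleinen_points[of f] Z by blast
qed

end

section \<open>Transfer to the sphere\<close>

text \<open>Any chart serves: only topological properties are carried over, smallness by uniform
  continuity. The hyperplane orthogonal to \<open>(0, 1)\<close> has real dimension two, like the
  complex plane.\<close>

lemma punctured_sphere_homeomorphism:
  fixes b :: "complex \<times> real"
  assumes "b \<in> sphere 0 1"
  obtains f :: "complex \<times> real \<Rightarrow> complex" and g where "homeomorphism (sphere 0 1 - {b}) UNIV f g"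
proof -
  let ?T = "{x :: complex \<times> real. (0, 1) \<bullet> x = 0}"
  have ne: "(0 :: complex, 1 :: real) \<noteq> 0" by (simp add: zero_prod_def)
  have "sphere 0 1 - {b} homeomorphic ?T"
    using homeomorphic_punctured_sphere_hyperplane[of 1 b 0 "(0, 1)" 0] assms ne by simp
  moreover have "?T homeomorphic (UNIV :: complex set)"
    by (rule homeomorphic_affine_sets) (use ne in \<open>simp_all add: affine_hyperplane aff_dim_hyperplane\<close>)
  ultimately have "sphere 0 1 - {b} homeomorphic (UNIV :: complex set)"
    using homeomorphic_trans by blast
  then show thesis using that by (auto simp: homeomorphic_def)
qed

lemma punctured_sphere_homeomorphism_image_open:
  assumes hom: "homeomorphism (sphere 0 1 - {k}) UNIV f g"
    and U: "openin (top_of_set (sphere 0 1)) U" "k \<notin> U"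
  shows "open (f ` U)"
proof -
  have "openin (top_of_set (sphere 0 1 - {k})) U"
    by (rule openin_subset_trans[OF U(1)]) (use U openin_imp_subset in auto)
  then show ?thesis using homeomorphism_imp_open_map[OF hom] by fastforce
qed

text \<open>A chart that omits a point \<open>k\<close> outside \<open>U\<close> makes
  \<open>U\<close> a connected open subset of the plane, where deleting a point is harmless.\<close>

lemma connected_open_sphere_delete:
  fixes U :: "(complex \<times> real) set"
  assumes U: "openin (top_of_set (sphere 0 1)) U" "connected U" and k: "k \<in> sphere 0 1 - U"
  shows "connected (U - {b})"
proof -
  obtain f :: "complex \<times> real \<Rightarrow> complex" and g where hom: "homeomorphism (sphere 0 1 - {k}) UNIV f g"
    using punctured_sphere_homeomorphism k by blast
  have sub: "U \<subseteq> sphere 0 1 - {k}" using U(1) k openin_imp_subset by blast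
  have homU: "homeomorphism U (f ` U) f g" by (rule homeomorphism_of_subsets[OF hom sub]) auto
  have "connected (f ` U)"
    using U(2) homU connected_continuous_image homeomorphism_cont1 by blast
  moreover have "open (f ` U)" using punctured_sphere_homeomorphism_image_open[OF hom U(1)] k by blast
  ultimately have "connected (f ` U - {f b})" using connected_open_delete[of "f ` U" "f b"] by simp
  moreover have "continuous_on (f ` U - {f b}) g"
    using homeomorphism_cont2[OF homU] continuous_on_subset by blast
  ultimately have "connected (g ` (f ` U - {f b}))" by (metis connected_continuous_image)
  moreover have "g ` (f ` U - {f b}) = U - {b}" if "b \<in> U"
  proof -
    have gf: "g (f x) = x" if "x \<in> U" for x using homeomorphism_apply1[OF homU that] .
    have "f ` U - {f b} = f ` (U - {b})"
      using inj_on_image_set_diff[of f U U "{b}"] inj_on_inverseI[of U g f] gf \<open>b \<in> U\<close> by auto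
    then show ?thesis using gf by (simp add: image_image cong: image_cong_simp)
  qed
  ultimately show ?thesis using U(2) by (cases "b \<in> U") simp_all
qed

text \<open>If the complement split into closed \<open>A\<close> and \<open>B\<close>, send a point
  \<open>k\<close> of \<open>A\<close> to infinity. The image of \<open>B\<close> is then compact
  and disjoint from the closed image of \<open>A - {k}\<close>, so a component of the planar
  complement that meets it is bounded, which simple connectivity of the image of \<open>U\<close>
  excludes.\<close>

lemma connected_Compl_simply_connected_sphere:
  fixes U :: "(complex \<times> real) set"
  assumes U: "openin (top_of_set (sphere 0 1)) U" "simply_connected U"
  shows "connected (sphere 0 1 - U)"
proof (rule ccontr)
  let ?K = "sphere 0 1 - U"
  assume nc: "\<not> connected ?K"
  have clK: "closed ?K"
  proof -
    obtain T where "open T" "U = sphere 0 1 \<inter> T" using U(1) by (auto simp: openin_open)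
    then have "?K = sphere 0 1 \<inter> - T" "closed (- T)" by auto
    then show ?thesis by (simp add: closed_Int)
  qed
  then obtain A B where AB: "closed A" "closed B" "A \<noteq> {}" "B \<noteq> {}" "A \<union> B = ?K" "A \<inter> B = {}"
    using nc unfolding connected_closed_set[OF clK] by blast
  obtain k where k: "k \<in> A" using AB by blast
  then have ks: "k \<in> sphere 0 1" "k \<notin> U" "k \<notin> B" using AB by auto
  obtain f :: "complex \<times> real \<Rightarrow> complex" and g where hom: "homeomorphism (sphere 0 1 - {k}) UNIV f g"
    using punctured_sphere_homeomorphism ks(1) by blast
  have Usub: "U \<subseteq> sphere 0 1 - {k}" using U(1) ks openin_imp_subset by blast
  have homU: "homeomorphism U (f ` U) f g" by (rule homeomorphism_of_subsets[OF hom Usub]) auto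
  have "simply_connected (f ` U)"
    using U(2) homeomorphic_simply_connected homU homeomorphic_def by blast
  moreover have "open (f ` U)" using punctured_sphere_homeomorphism_image_open[OF hom U(1) ks(2)] .
  ultimately have unb: "\<And>c. c \<in> components (- f ` U) \<Longrightarrow> \<not> bounded c"
    using simply_connected_eq_unbounded_complement_components by blast
  have sub: "A - {k} \<subseteq> sphere 0 1 - {k}" "B \<subseteq> sphere 0 1 - {k}" using AB ks by auto
  have clA: "closed (f ` (A - {k}))"
  proof -
    have "closedin (top_of_set (sphere 0 1 - {k})) (A - {k})"
      using AB(1) sub(1) unfolding closedin_closed by (intro exI[of _ A]) auto
    then show ?thesis using homeomorphism_imp_closed_map[OF hom] by fastforce
  qed
  have coB: "compact (f ` B)"
  proof (rule compact_continuous_image)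
    show "continuous_on B f" using homeomorphism_cont1[OF hom] sub continuous_on_subset by blast
    have "B \<subseteq> sphere 0 1" using sub by blast
    then show "compact B" using AB(2) by (metis compact_Int_closed compact_sphere inf.absorb_iff2)
  qed
  have img: "- f ` U = f ` (A - {k}) \<union> f ` B"
  proof -
    have inj: "inj_on f (sphere 0 1 - {k})" using hom unfolding homeomorphism_def inj_on_def by metis
    have "U \<union> ((A - {k}) \<union> B) = sphere 0 1 - {k}" using AB Usub ks by blast
    then have "f ` U \<union> f ` ((A - {k}) \<union> B) = UNIV" using hom unfolding homeomorphism_def image_Un[symmetric] by simp
    moreover have "U \<inter> ((A - {k}) \<union> B) = {}" using AB by auto
    then have "f ` U \<inter> f ` ((A - {k}) \<union> B) = {}"
      using inj_on_image_Int[OF inj Usub, of "(A - {k}) \<union> B"] sub by auto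
    ultimately show ?thesis unfolding image_Un by blast
  qed
  have disj: "f ` (A - {k}) \<inter> f ` B = {}"
  proof -
    have inj: "inj_on f (sphere 0 1 - {k})" using hom unfolding homeomorphism_def inj_on_def by metis
    show ?thesis using inj_on_image_Int[OF inj sub] AB by auto
  qed
  define P Q where "P = f ` (A - {k})" and "Q = f ` B"
  note PQ = img[folded P_def Q_def] disj[folded P_def Q_def] clA[folded P_def] compact_imp_closed[OF coB[folded Q_def]]
  obtain y where y: "y \<in> Q" using AB(4) Q_def by blast
  define c where "c = connected_component_set (- f ` U) y"
  have yc: "y \<in> - f ` U" using y PQ(1) by blast
  have c: "connected c" "c \<subseteq> - f ` U" "y \<in> c" "c \<in> components (- f ` U)"
    using yc by (auto simp: c_def connected_component_refl_eq connected_component_subset componentsI)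
  have "P \<inter> Q \<inter> c = {}" "c \<subseteq> P \<union> Q" using PQ(1,2) c(2) by simp_all
  then have "P \<inter> c = {} \<or> Q \<inter> c = {}"
    using connected_closedD[OF c(1) _ _ PQ(3,4)] by simp
  then have "c \<subseteq> f ` B" using c(2,3) PQ(1) y unfolding Q_def[symmetric] by blast
  then have "bounded c" using coB compact_imp_bounded bounded_subset by blast
  then show False using unb c(4) by blast
qed

lemma spherical_diameter_small:
  assumes C: "\<And>n. C n \<subseteq> riemann_sphere" and lim: "(\<lambda>n. spherical_diameter (C n)) \<longlonglongrightarrow> 0" and e: "e > 0"
  shows "\<forall>\<^sub>F n in sequentially. \<forall>x\<in>C n. \<forall>y\<in>C n. dist x y < e"
proof -
  \<comment> \<open>The angle that belongs to the chord length \<open>e\<close>, as the squared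
    chord between unit vectors is \<open>2 - 2 * (x \<bullet> y)\<close>. The maximum with -1 keeps
    the argument in the domain of \<open>arccos\<close> when \<open>e\<close> exceeds 2.\<close>
  define d where "d = arccos (max (-1) (1 - e\<^sup>2 / 2))"
  have "0 < e\<^sup>2 / 2" using e by simp
  then have m: "- 1 \<le> max (-1) (1 - e\<^sup>2 / 2)" "max (-1) (1 - e\<^sup>2 / 2) < 1" by auto
  have "d > 0" using arccos_less_arccos[of "max (-1) (1 - e\<^sup>2 / 2)" 1] m by (simp add: d_def)
  then have "\<forall>\<^sub>F n in sequentially. spherical_diameter (C n) < d" using lim by (simp add: order_tendstoD(2))
  then show ?thesis
  proof eventually_elim
    case (elim n)
    show ?case
    proof (intro ballI)
      fix x y assume xy: "x \<in> C n" "y \<in> C n"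
      have nrm: "norm x = 1" "norm y = 1" if "x \<in> C n" "y \<in> C n" for x y using that C[of n] by (auto simp: riemann_sphere_def)
      have in1: "\<bar>x \<bullet> y\<bar> \<le> 1" if "x \<in> C n" "y \<in> C n" for x y
        using Cauchy_Schwarz_ineq2[of x y] nrm[OF that] by simp
      \<comment> \<open>A real supremum is known to dominate its members only for a bounded family;
        here \<open>pi\<close> is a bound.\<close>
      have "bdd_above ((\<lambda>(x, y). spherical_dist x y) ` (C n \<times> C n))"
        using in1 by (intro bdd_aboveI[of _ pi]) (auto simp: spherical_dist_def abs_le_iff intro!: arccos_ubound)
      then have "spherical_dist x y \<le> spherical_diameter (C n)"
        unfolding spherical_diameter_def using xy by (intro cSUP_upper2[of _ _ "(x, y)"]) auto
      then have "arccos (x \<bullet> y) < arccos (max (-1) (1 - e\<^sup>2 / 2))" using elim by (simp add: spherical_dist_def d_def)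
      then have "max (-1) (1 - e\<^sup>2 / 2) < x \<bullet> y"
        using arccos_less_mono[of "x \<bullet> y" "max (-1) (1 - e\<^sup>2 / 2)"] in1[OF xy] m by simp
      then have "2 - 2 * (x \<bullet> y) < e\<^sup>2" by simp
      moreover have "(dist x y)\<^sup>2 = 2 - 2 * (x \<bullet> y)"
        using nrm[OF xy] by (simp add: dist_norm power2_norm_eq_inner inner_diff_left inner_diff_right inner_commute norm_eq_1)
      ultimately show "dist x y < e" using e by (simp add: power2_less_imp_less)
    qed
  qed
qed

section \<open>The domain in a chart that sends its base point to infinity\<close>

locale charted_sphere_domain =
  fixes U K :: "(complex \<times> real) set" and b :: "complex \<times> real"
    and f :: "complex \<times> real \<Rightarrow> complex" and g :: "complex \<Rightarrow> complex \<times> real"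
  assumes opU: "openin (top_of_set (sphere 0 1)) U" and conU: "connected U" and scU: "simply_connected U"
    and K_def: "K = sphere 0 1 - U" and K_ne: "K \<noteq> {}" and bU: "b \<in> U"
    and hom: "homeomorphism (sphere 0 1 - {b}) UNIV f g"
begin

lemma U_subset: "U \<subseteq> sphere 0 1"
  using opU openin_imp_subset by blast

lemma gf [simp]: "x \<in> sphere 0 1 \<Longrightarrow> x \<noteq> b \<Longrightarrow> g (f x) = x"
  using homeomorphism_apply1[OF hom] by simp

lemma gf_subset: "S \<subseteq> sphere 0 1 - {b} \<Longrightarrow> x \<in> S \<Longrightarrow> g (f x) = x"
  using homeomorphism_apply1[OF hom] by blast

lemma fg [simp]: "f (g y) = y"
  using homeomorphism_apply2[OF hom] by simp

lemma g_mem: "g y \<in> sphere 0 1" "g y \<noteq> b"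
proof -
  have "g ` UNIV = sphere 0 1 - {b}" using hom by (simp add: homeomorphism_def)
  then have "g y \<in> sphere 0 1 - {b}" by blast
  then show "g y \<in> sphere 0 1" "g y \<noteq> b" by auto
qed

lemma cont_f: "S \<subseteq> sphere 0 1 - {b} \<Longrightarrow> continuous_on S f"
  using homeomorphism_cont1[OF hom] continuous_on_subset by blast

lemma cont_g: "continuous_on S g"
  using homeomorphism_cont2[OF hom] continuous_on_subset by blast

lemma f_mem_iff: "A \<subseteq> sphere 0 1 - {b} \<Longrightarrow> x \<in> sphere 0 1 - {b} \<Longrightarrow> f x \<in> f ` A \<longleftrightarrow> x \<in> A"
  using gf by (smt (verit, best) Diff_iff image_iff insertCI subset_eq)

lemma K_subset: "K \<subseteq> sphere 0 1 - {b}"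
  using K_def bU by blast

lemma compact_K: "compact K"
proof -
  obtain T where "open T" "U = sphere 0 1 \<inter> T" using opU by (auto simp: openin_open)
  then have "K = sphere 0 1 \<inter> - T" "closed (- T)" by (auto simp: K_def)
  then show ?thesis by (simp add: compact_Int_closed)
qed

lemma Compl_fK: "- f ` K = f ` (U - {b})"
proof -
  have 1: "U - {b} \<subseteq> sphere 0 1 - {b}" using U_subset by blast
  have "y \<in> f ` K \<longleftrightarrow> y \<notin> f ` (U - {b})" for y
    using f_mem_iff[OF K_subset, of "g y"] f_mem_iff[OF 1, of "g y"] g_mem[of y] K_def by auto
  then show ?thesis by blast
qed

text \<open>The image of \<open>K\<close> is connected because \<open>U\<close> is simply connected.
  Its complement is the image of the connected open set \<open>U\<close> with one point
  deleted.\<close>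

lemma fK: "compact (f ` K)" "connected (f ` K)" "connected (- f ` K)"
proof -
  show "compact (f ` K)" by (rule compact_continuous_image[OF cont_f[OF K_subset] compact_K])
  show "connected (f ` K)"
    by (rule connected_continuous_image[OF cont_f[OF K_subset]])
      (use connected_Compl_simply_connected_sphere[OF opU scU] K_def in simp)
  obtain k where "k \<in> sphere 0 1 - U" using K_ne K_def by blast
  then have "connected (U - {b})" using connected_open_sphere_delete[OF opU conU] by blast
  moreover have "continuous_on (U - {b}) f" using U_subset by (intro cont_f) auto
  ultimately show "connected (- f ` K)" unfolding Compl_fK by (metis connected_continuous_image)
qed

lemma crosscut_subset: "crosscut U C \<Longrightarrow> b \<notin> C \<Longrightarrow> C \<subseteq> sphere 0 1 - {b}"
  by (auto simp: crosscut_def riemann_sphere_def)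

lemma plane_crosscut_image:
  assumes C: "crosscut U C" "b \<notin> C"
  shows "plane_crosscut (f ` K) (f ` C)"
proof -
  obtain h where h: "arc h" "C = path_image h" "C \<inter> K = {pathstart h, pathfinish h}"
    using C(1) unfolding crosscut_def K_def riemann_sphere_def by blast
  note sub = crosscut_subset[OF C]
  have inj: "inj_on f (sphere 0 1 - {b})" by (rule inj_on_inverseI[of _ g]) auto
  have "arc (f \<circ> h)"
    unfolding arc_def
  proof
    show "path (f \<circ> h)" using h cont_f[OF sub] by (intro path_continuous_image) (auto simp: arc_def)
    show "inj_on (f \<circ> h) {0..1}"
      using h inj_on_subset[OF inj sub] by (intro comp_inj_on) (auto simp: arc_def path_image_def)
  qed
  moreover have "f ` C = path_image (f \<circ> h)" by (simp add: h(2) path_image_compose)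
  moreover have "f ` C \<inter> f ` K = {pathstart (f \<circ> h), pathfinish (f \<circ> h)}"
    using inj_on_image_Int[OF inj sub K_subset] h(3) by (simp add: pathstart_compose pathfinish_compose)
  ultimately show ?thesis unfolding plane_crosscut_def by blast
qed

text \<open>The chart sends \<open>b\<close> to infinity, so the component of \<open>U - C\<close> without \<open>b\<close> is the bounded one.\<close>

lemma crosscut_component_eq:
  assumes C: "crosscut U C" "b \<notin> C"
  shows "crosscut_component U b C = g ` inside (f ` K \<union> f ` C)"
proof -
  define I O' where "I = inside (f ` K \<union> f ` C)" and "O' = outside (f ` K \<union> f ` C)"
  note sub = crosscut_subset[OF C] and pc = plane_crosscut_image[OF C]
  have cpt: "compact (f ` K \<union> f ` C)" using fK plane_crosscut_compact[OF pc] by (simp add: compact_Un)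
  have I_con: "connected I" and I_ne: "I \<noteq> {}"
    unfolding I_def using connected_inside_crosscut[OF fK(1,3) pc] inside_crosscut_nonempty[OF fK(1,2) pc] .
  have O_con: "connected O'"
    unfolding O'_def by (intro connected_outside compact_imp_bounded cpt) simp
  have IO: "I \<inter> O' = {}" "I \<union> O' = - (f ` K \<union> f ` C)" unfolding I_def O'_def by simp_all
  have UC_iff: "g y \<in> U - C \<longleftrightarrow> y \<in> I \<union> O'" for y
    using f_mem_iff[OF K_subset, of "g y"] f_mem_iff[OF sub, of "g y"] g_mem[of y] K_def IO(2) by auto
  \<comment> \<open>The outer region on the sphere includes \<open>b\<close>: the complement of
    \<open>O'\<close> has a compact image that misses \<open>b\<close>, and \<open>b\<close> is a
    limit point of the sphere, so \<open>b\<close> is in the closure of the image of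
    \<open>O'\<close>.\<close>
  have O_con': "connected (insert b (g ` O'))"
  proof (rule connected_intermediate_closure)
    show "connected (g ` O')" by (rule connected_continuous_image[OF cont_g O_con])
    have "compact (- O')"
    proof -
      have "closed (- O')" unfolding O'_def using cpt by (intro closed_Compl open_outside compact_imp_closed)
      moreover have "bounded (- O')" unfolding O'_def using cpt by (intro cobounded_outside compact_imp_bounded)
      ultimately show ?thesis by (simp add: compact_eq_bounded_closed)
    qed
    then have clo: "closed (g ` (- O'))" using compact_continuous_image[OF cont_g] compact_imp_closed by blast
    have "sphere 0 1 - {b} = g ` O' \<union> g ` (- O')"
      using hom unfolding homeomorphism_def image_Un[symmetric] by simp
    then have "closure (sphere 0 1 - {b}) = closure (g ` O') \<union> g ` (- O')"
      using clo by (simp add: closure_Un)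
    moreover have "b \<in> closure (sphere 0 1 - {b})"
    proof -
      have "b \<in> sphere 0 1" using bU U_subset by blast
      moreover have "sphere 0 1 \<noteq> {x}" for x :: "complex \<times> real"
        using K_ne K_subset \<open>b \<in> sphere 0 1\<close> by (metis Diff_cancel singletonD subset_empty)
      moreover have "connected (sphere 0 1 :: (complex \<times> real) set)" by (rule connected_sphere) simp
      ultimately have "b islimpt sphere 0 1" by (intro connected_imp_perfect)
      then show ?thesis by (simp add: islimpt_in_closure)
    qed
    moreover have "b \<notin> g ` (- O')" using g_mem by blast
    ultimately have "b \<in> closure (g ` O')" by blast
    then show "insert b (g ` O') \<subseteq> closure (g ` O')" by (simp add: closure_subset)
  qed auto
  have gI_con: "connected (g ` I)" by (rule connected_continuous_image[OF cont_g I_con])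
  have unique: "V = g ` I" if V: "V \<in> components (U - C)" "b \<notin> V" for V
  proof -
    have Vsub: "V \<subseteq> U - C" using V(1) in_components_subset by blast
    then have Vs: "V \<subseteq> sphere 0 1 - {b}" using V(2) U_subset by blast
    have gfV: "g (f x) = x" if "x \<in> V" for x by (rule gf_subset[OF Vs that])
    then have V_eq: "V = g ` f ` V" by (simp add: image_image)
    have fV: "connected (f ` V)"
      by (rule connected_continuous_image[OF cont_f[OF Vs]]) (use V(1) in_components_connected in blast)
    have fVsub: "f ` V \<subseteq> - (f ` K \<union> f ` C)"
    proof
      fix y assume "y \<in> f ` V"
      then have "g y \<in> U - C" using gfV Vsub by auto
      then show "y \<in> - (f ` K \<union> f ` C)" using UC_iff IO(2) by blast
    qed
    obtain x where x: "x \<in> V" using V(1) in_components_nonempty by blast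
    \<comment> \<open>A component with a point in the outer region absorbs that region together with
      \<open>b\<close>, by maximality.\<close>
    have "f x \<notin> O'"
    proof
      assume "f x \<in> O'"
      then have "f ` V \<subseteq> O'"
        using connected_subset_outside[OF fV fVsub, of "f x"] x by (simp add: O'_def)
      then have "V \<subseteq> insert b (g ` O')" using V_eq by blast
      moreover have "insert b (g ` O') \<subseteq> U - C" using UC_iff bU C(2) by blast
      ultimately have "insert b (g ` O') \<subseteq> V"
        using components_maximal[OF V(1) O_con'] x by blast
      then show False using V(2) by blast
    qed
    then have "f x \<in> I" using fVsub x IO(2) by blast
    then have fVI: "f ` V \<subseteq> I"
      using connected_subset_inside[OF fV fVsub, of "f x"] x by (simp add: I_def)
    then have "V \<subseteq> g ` I" using V_eq by blast
    moreover have "g ` I \<subseteq> U - C" using UC_iff by blast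
    ultimately show ?thesis using components_maximal[OF V(1) gI_con] x by blast
  qed
  obtain y where y: "y \<in> I" using I_ne by blast
  then have "g y \<in> U - C" using UC_iff by blast
  then obtain V where V: "V \<in> components (U - C)" "g y \<in> V"
    using Union_components[of "U - C"] by blast
  have "b \<notin> V"
  proof
    \<comment> \<open>\<open>E1\<close> and \<open>E2\<close> are closed, cover \<open>U - C\<close>
      and are disjoint there; \<open>g y\<close> lies in the first and \<open>b\<close> in the
      second, so no component contains both.\<close>
    assume bV: "b \<in> V"
    define E1 E2 where "E1 = g ` closure I" and "E2 = sphere 0 1 - g ` I"
    have "compact (closure I)"
      unfolding I_def compact_closure by (intro bounded_inside compact_imp_bounded cpt)
    then have E1: "closed E1"
      unfolding E1_def by (intro compact_imp_closed compact_continuous_image[OF cont_g])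
    have E2: "closed E2"
    proof -
      have "open I" unfolding I_def using cpt by (intro open_inside compact_imp_closed)
      then have "openin (top_of_set (sphere 0 1 - {b})) (g ` I)"
        using homeomorphism_imp_open_map[OF homeomorphism_symD[OF hom], of I] by simp
      then have "openin (top_of_set (sphere 0 1)) (g ` I)"
        by (rule openin_trans) (intro openin_delete openin_subtopology_self)
      then obtain T where T: "open T" "g ` I = sphere 0 1 \<inter> T" by (auto simp: openin_open)
      then have "E2 = sphere 0 1 \<inter> - T" unfolding E2_def by blast
      then show ?thesis using closed_Int[OF closed_sphere closed_Compl[OF T(1)]] by simp
    qed
    have Vsub: "V \<subseteq> U - C" using V(1) in_components_subset by blast
    have "closure I \<subseteq> (f ` K \<union> f ` C) \<union> I" unfolding I_def
      by (rule closure_inside_subset) (use cpt compact_imp_closed in blast)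
    then have "closure I \<inter> O' = {}" using IO by blast
    then have "E1 \<inter> V \<subseteq> g ` I"
      using Vsub UC_iff unfolding E1_def by blast
    then have "E1 \<inter> E2 \<inter> V = {}" unfolding E2_def by blast
    moreover have "V \<subseteq> E1 \<union> E2" using Vsub U_subset closure_subset[of I] unfolding E1_def E2_def by blast
    ultimately have "E1 \<inter> V = {} \<or> E2 \<inter> V = {}"
      using connected_closedD[OF in_components_connected[OF V(1)] _ _ E1 E2] by blast
    moreover have "g y \<in> E1" using y closure_subset unfolding E1_def by blast
    moreover have "b \<in> E2" using bU U_subset g_mem unfolding E2_def by blast
    ultimately show False using V(2) bV by blast
  qed
  then have "g ` I \<in> components (U - C) \<and> b \<notin> g ` I" using unique[OF V(1)] V(1) by simp
  then have "(THE V. V \<in> components (U - C) \<and> b \<notin> V) = g ` I"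
    by (rule the_equality) (use unique in blast)
  then show ?thesis unfolding crosscut_component_def I_def .
qed

lemma crosscut_component_mono:
  assumes C: "crosscut U C" "b \<notin> C" and D: "crosscut U D" "b \<notin> D"
    and sub: "D \<inter> U \<subseteq> crosscut_component U b C"
  shows "crosscut_component U b D \<subseteq> crosscut_component U b C"
proof -
  have "f ` D - f ` K \<subseteq> inside (f ` K \<union> f ` C)"
  proof
    fix y assume "y \<in> f ` D - f ` K"
    then obtain x where x: "x \<in> D" "y = f x" "x \<notin> K" by blast
    then have "x \<in> D \<inter> U" using crosscut_subset[OF D] K_def by blast
    then obtain w where "w \<in> inside (f ` K \<union> f ` C)" "x = g w"
      using sub unfolding crosscut_component_eq[OF C] by blast
    then show "y \<in> inside (f ` K \<union> f ` C)" using x by simp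
  qed
  then show ?thesis
    unfolding crosscut_component_eq[OF C] crosscut_component_eq[OF D]
    by (intro image_mono inside_crosscut_mono[OF fK(1,3) plane_crosscut_image[OF C]])
qed

text \<open>The inner region is bounded, so its planar closure is compact with a closed image.
  Taking the closure on the sphere therefore adds no point that the chart omits.\<close>

lemma closure_crosscut_component:
  assumes C: "crosscut U C" "b \<notin> C" and x: "x \<in> closure (crosscut_component U b C)"
  shows "f x \<in> closure (inside (f ` K \<union> f ` C))"
proof -
  let ?I = "inside (f ` K \<union> f ` C)"
  have "bounded ?I"
    by (intro bounded_inside compact_imp_bounded compact_Un fK(1)
        plane_crosscut_compact[OF plane_crosscut_image[OF C]])
  then have "compact (closure ?I)" by simp
  then have "closed (g ` closure ?I)"
    using compact_continuous_image[OF cont_g] compact_imp_closed by blast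
  then have "closure (g ` ?I) \<subseteq> g ` closure ?I"
    using closure_subset[of ?I] by (intro closure_minimal image_mono) auto
  then have "x \<in> g ` closure ?I" using x unfolding crosscut_component_eq[OF C] by blast
  then show ?thesis by auto
qed

text \<open>\<open>f\<close> is not uniformly continuous near \<open>b\<close>. But \<open>K\<close>
  has positive distance from \<open>b\<close> and every crosscut touches \<open>K\<close>, so short
  ones stay in a compact set \<open>Q\<close> away from \<open>b\<close>, where \<open>f\<close> is
  uniformly continuous.\<close>

lemma small_image:
  assumes C: "\<And>n. C n \<subseteq> sphere 0 1 - {b}" "\<And>n. C n \<inter> K \<noteq> {}"
    and small: "\<And>e. e > 0 \<Longrightarrow> \<forall>\<^sub>F n in sequentially. \<forall>x\<in>C n. \<forall>y\<in>C n. dist x y < e"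
    and e: "e > 0"
  shows "\<forall>\<^sub>F n in sequentially. \<forall>x\<in>f ` C n. \<forall>y\<in>f ` C n. dist x y < e"
proof -
  have bK: "b \<notin> K" using K_subset by blast
  obtain d where d: "d > 0" "\<And>y. y \<in> K \<Longrightarrow> d \<le> dist b y"
    using separate_point_closed[OF compact_imp_closed[OF compact_K] bK] by auto
  define Q where "Q = sphere 0 1 - ball b (d / 2)"
  have "Q \<subseteq> sphere 0 1 - {b}" using d(1) by (auto simp: Q_def)
  moreover have "compact Q" unfolding Q_def Diff_eq by (intro compact_Int_closed) auto
  ultimately have "uniformly_continuous_on Q f" using compact_uniformly_continuous cont_f by blast
  then obtain r where r: "r > 0" "\<And>x y. x \<in> Q \<Longrightarrow> y \<in> Q \<Longrightarrow> dist x y < r \<Longrightarrow> dist (f x) (f y) < e"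
    using e unfolding uniformly_continuous_on_def by metis
  have "\<forall>\<^sub>F n in sequentially. \<forall>x\<in>C n. \<forall>y\<in>C n. dist x y < min r (d / 2)"
    by (rule small) (use r d in simp)
  then show ?thesis
  proof eventually_elim
    case (elim n)
    obtain k where k: "k \<in> C n" "k \<in> K" using C(2) by blast
    have "C n \<subseteq> Q"
    proof
      fix x assume x: "x \<in> C n"
      have "dist x k < d / 2" using elim k x by auto
      then have "d / 2 \<le> dist b x" using d(2)[OF k(2)] dist_triangle[of b k x] by linarith
      then show "x \<in> Q" using C(1)[of n] x by (auto simp: Q_def)
    qed
    then have "dist (f x) (f y) < e" if "x \<in> C n" "y \<in> C n" for x y
      using r(2)[of x y] elim that by auto
    then show ?case by blast
  qed
qed

section \<open>Prime ends and their impressions\<close>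

lemma prime_end_sequenceD:
  assumes "C \<in> prime_end_sequences U b"
  shows "crosscut U (C n)" "b \<notin> C n" "C n \<inter> C (Suc n) = {}"
    "C (Suc n) \<subseteq> closure (crosscut_component U b (C n))"
    "(\<lambda>n. spherical_diameter (C n)) \<longlonglongrightarrow> 0"
proof -
  have "disjoint_family C" using assms by (simp add: prime_end_sequences_def)
  then show "C n \<inter> C (Suc n) = {}" using disjoint_family_onD[of C UNIV n "Suc n"] by simp
qed (use assms in \<open>simp_all add: prime_end_sequences_def\<close>)

lemma plane_crosscut_chain:
  assumes C: "C \<in> prime_end_sequences U b"
  shows "plane_crosscut_chain (f ` K) (\<lambda>n. f ` C n)"
proof
  note D = prime_end_sequenceD[OF C]
  show "compact (f ` K)" "connected (f ` K)" "connected (- f ` K)" by (fact fK)+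
  show "plane_crosscut (f ` K) (f ` C n)" for n by (rule plane_crosscut_image[OF D(1,2)])
  show "f ` C n \<inter> f ` C (Suc n) = {}" for n
  proof -
    have inj: "inj_on f (sphere 0 1 - {b})" by (rule inj_on_inverseI[of _ g]) auto
    show ?thesis using inj_on_image_Int[OF inj crosscut_subset[OF D(1,2)] crosscut_subset[OF D(1,2)], of n "Suc n"] D(3)[of n] by simp
  qed
  show "f ` C (Suc n) \<subseteq> closure (inside (f ` K \<union> f ` C n))" for n
    using closure_crosscut_component[OF D(1,2)] D(4) by blast
  show "\<forall>\<^sub>F n in sequentially. \<forall>x\<in>f ` C n. \<forall>y\<in>f ` C n. dist x y < e" if e: "e > 0" for e
  proof (rule small_image[OF _ _ _ e])
    show "C n \<subseteq> sphere 0 1 - {b}" for n by (rule crosscut_subset[OF D(1,2)])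
    show "C n \<inter> K \<noteq> {}" for n
      using D(1)[of n] unfolding crosscut_def K_def riemann_sphere_def by blast
    have "\<And>n. C n \<subseteq> riemann_sphere" using D(1) by (auto simp: crosscut_def)
    then show "\<forall>\<^sub>F n in sequentially. \<forall>x\<in>C n. \<forall>y\<in>C n. dist x y < r" if "r > 0" for r
      using spherical_diameter_small D(5) that by blast
  qed
qed

text \<open>Reflexivity puts a representative into its own class, so that a prime end is
  nonempty.\<close>

lemma prime_end_equiv_refl:
  assumes C: "C \<in> prime_end_sequences U b"
  shows "(C, C) \<in> prime_end_equiv U b"
proof -
  note D = prime_end_sequenceD[OF C]
  interpret plane: plane_crosscut_chain "f ` K" "\<lambda>n. f ` C n" by (rule plane_crosscut_chain[OF C])
  have "C j \<inter> U \<subseteq> crosscut_component U b (C n)" if nj: "j > n" for n j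
  proof
    fix x assume x: "x \<in> C j \<inter> U"
    obtain i where i: "j = Suc i" "n \<le> i" using nj by (cases j) auto
    have xs: "x \<in> sphere 0 1 - {b}" using x crosscut_subset[OF D(1,2)] by blast
    then have "f x \<notin> f ` K" using f_mem_iff[OF K_subset] x K_def by blast
    then have "f x \<in> inside (f ` K \<union> f ` C i)" using plane.next_crosscut[of i] x i(1) by blast
    then have "f x \<in> inside (f ` K \<union> f ` C n)" using plane.inside_antimono[OF i(2)] by blast
    then show "x \<in> crosscut_component U b (C n)"
      unfolding crosscut_component_eq[OF D(1,2)] using xs by (intro image_eqI[of _ _ "f x"]) auto
  qed
  then have "\<forall>\<^sub>F j in sequentially. C j \<inter> U \<subseteq> crosscut_component U b (C n)" for n
    by (intro eventually_mono[OF eventually_gt_at_top[of n]])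
  then show ?thesis using C by (simp add: prime_end_equiv_def)
qed

text \<open>A single \<open>D j\<close> that enters the component of \<open>C n\<close> brings its
  whole component along, by \<open>crosscut_component_mono\<close>.\<close>

lemma prime_end_equiv_imp_Inter_subset:
  assumes CD: "(C, D) \<in> prime_end_equiv U b"
  shows "(\<Inter>n. closure (crosscut_component U b (D n))) \<subseteq> (\<Inter>n. closure (crosscut_component U b (C n)))"
proof (rule INT_greatest)
  fix n
  have C: "C \<in> prime_end_sequences U b" and D: "D \<in> prime_end_sequences U b"
    and ev: "\<forall>\<^sub>F j in sequentially. D j \<inter> U \<subseteq> crosscut_component U b (C n)"
    using CD by (auto simp: prime_end_equiv_def)
  obtain j where "D j \<inter> U \<subseteq> crosscut_component U b (C n)"
    using ev eventually_happens' sequentially_bot by blast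
  then have "crosscut_component U b (D j) \<subseteq> crosscut_component U b (C n)"
    using crosscut_component_mono prime_end_sequenceD(1,2)[OF C] prime_end_sequenceD(1,2)[OF D] by blast
  then show "(\<Inter>n. closure (crosscut_component U b (D n))) \<subseteq> closure (crosscut_component U b (C n))"
    using closure_mono by blast
qed

lemma prime_end_equiv_sym: "(C, D) \<in> prime_end_equiv U b \<Longrightarrow> (D, C) \<in> prime_end_equiv U b"
  by (auto simp: prime_end_equiv_def)

text \<open>The definite description in \<open>impression\<close> denotes a set because equivalent
  sequences have the same intersection and the class contains at least \<open>C\<close>.\<close>

lemma impression_eq:
  assumes "p \<in> prime_ends U b"
  obtains C where "C \<in> prime_end_sequences U b"
    "impression U b p = (\<Inter>n. closure (crosscut_component U b (C n)))"
proof -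
  obtain C where C: "C \<in> prime_end_sequences U b" "p = prime_end_equiv U b `` {C}"
    using assms unfolding prime_ends_def by (elim quotientE)
  let ?I = "\<lambda>C. \<Inter>n. closure (crosscut_component U b (C n))"
  have Cp: "C \<in> p" using C prime_end_equiv_refl by simp
  have eq: "?I C = ?I D" if "D \<in> p" for D
  proof -
    have "(C, D) \<in> prime_end_equiv U b" using that C(2) by simp
    then show ?thesis using prime_end_equiv_imp_Inter_subset prime_end_equiv_sym by (metis subset_antisym)
  qed
  have "impression U b p = ?I C"
    unfolding impression_def
  proof (rule the_equality)
    show "\<forall>D\<in>p. ?I C = ?I D" using eq by blast
    show "J = ?I C" if "\<forall>D\<in>p. J = ?I D" for J using bspec[OF that Cp] .
  qed
  then show thesis using that C(1) by blast
qed

lemma im_kleinen_image: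
  assumes "locally_connected_at_point K z"
  shows "im_kleinen_at (f ` K) (f z)"
  unfolding im_kleinen_at_def
proof (intro conjI allI impI)
  have z: "z \<in> K" and nb: "neighbourhood_base_at z (connectedin (top_of_set K)) (top_of_set K)"
    using assms by (auto simp: locally_connected_at_point_def weakly_locally_connected_at_def)
  show "f z \<in> f ` K" using z by blast
  fix e :: real assume e: "e > 0"
  have "openin (top_of_set K) (K \<inter> f -` ball (f z) e)"
    by (rule continuous_openin_preimage_gen[OF cont_f[OF K_subset] open_ball])
  then obtain A X where A: "openin (top_of_set K) A" "z \<in> A" "A \<subseteq> X"
    and X: "connectedin (top_of_set K) X" "X \<subseteq> K \<inter> f -` ball (f z) e"
    using nb z e unfolding neighbourhood_base_at_def by (metis IntI centre_in_ball vimageI)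
  have "homeomorphism K (f ` K) f g" by (rule homeomorphism_of_subsets[OF hom K_subset]) auto
  then have "openin (top_of_set (f ` K)) (f ` A)" using homeomorphism_imp_open_map A(1) by blast
  then obtain d where d: "d > 0" "ball (f z) d \<inter> f ` K \<subseteq> f ` A"
    using A(2) unfolding openin_contains_ball by blast
  have "connected X" using X(1) by (simp add: connectedin_subtopology)
  then have "connected (f ` X)"
    using X(2) K_subset by (intro connected_continuous_image cont_f) auto
  moreover have "f ` X \<subseteq> f ` K \<inter> ball (f z) e" using X(2) by blast
  moreover have "f ` K \<inter> ball (f z) d \<subseteq> f ` X" using d(2) A(3) by blast
  ultimately show "\<exists>d>0. \<exists>X. connected X \<and> X \<subseteq> f ` K \<inter> ball (f z) e \<and> f ` K \<inter> ball (f z) d \<subseteq> X"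
    using d(1) by blast
qed

lemma impression_locally_connected_points:
  assumes p: "p \<in> prime_ends U b"
  shows "finite {z \<in> impression U b p. locally_connected_at_point K z} \<and>
         card {z \<in> impression U b p. locally_connected_at_point K z} \<le> 2"
proof -
  obtain C where C: "C \<in> prime_end_sequences U b"
    "impression U b p = (\<Inter>n. closure (crosscut_component U b (C n)))"
    using impression_eq[OF p] .
  interpret plane: plane_crosscut_chain "f ` K" "\<lambda>n. f ` C n" by (rule plane_crosscut_chain[OF C(1)])
  define Z where "Z = {z \<in> impression U b p. locally_connected_at_point K z}"
  \<comment> \<open>Counting images is enough, as \<open>f\<close> is injective on \<open>K\<close>,
    which contains \<open>Z\<close>.\<close>
  have "finite (f ` Z) \<and> card (f ` Z) \<le> 2"
  proof (rule plane.im_kleinen_points_at_most_two)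
    fix y assume "y \<in> f ` Z"
    then obtain z where z: "z \<in> impression U b p" "locally_connected_at_point K z" "y = f z" by (auto simp: Z_def)
    show "im_kleinen_at (f ` K) y" using im_kleinen_image z by blast
    show "y \<in> closure (inside (f ` K \<union> f ` C n))" for n
      using closure_crosscut_component[OF prime_end_sequenceD(1,2)[OF C(1)]] z C(2) by blast
  qed
  moreover have "inj_on f Z"
  proof (rule inj_on_inverseI[of _ g])
    fix z assume "z \<in> Z"
    then have "z \<in> K" by (auto simp: Z_def locally_connected_at_point_def)
    then show "g (f z) = z" by (rule gf_subset[OF K_subset])
  qed
  ultimately have "finite Z \<and> card Z \<le> 2" by (simp add: finite_image_iff card_image)
  then show ?thesis unfolding Z_def .
qed

end

theorem theorem1p1:
  fixes U K :: "(complex \<times> real) set" and b :: "complex \<times> real"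
    and p :: "(nat \<Rightarrow> (complex \<times> real) set) set"
  assumes "openin (top_of_set riemann_sphere) U"
    and "connected U"
    and "simply_connected U"
    and "K = riemann_sphere - U"
    and "\<exists>x\<in>K. \<exists>y\<in>K. x \<noteq> y"
    and "b \<in> U"
    and "p \<in> prime_ends U b"
  shows "finite {z \<in> impression U b p. locally_connected_at_point K z} \<and>
         card {z \<in> impression U b p. locally_connected_at_point K z} \<le> 2"
proof -
  have "b \<in> sphere 0 1"
    using assms(1,6) openin_imp_subset unfolding riemann_sphere_def by blast
  then obtain f :: "complex \<times> real \<Rightarrow> complex" and g where "homeomorphism (sphere 0 1 - {b}) UNIV f g"
    using punctured_sphere_homeomorphism by blast
  then interpret charted_sphere_domain U K b f g
    using assms unfolding riemann_sphere_def by unfold_locales auto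
  show ?thesis by (rule impression_locally_connected_points) fact
qed

end
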